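(* Let $\ell,m\in\mathbb{Z}_{\geq1}$ and $\omega=(m,-\ell)$. Put $\lambda=((\ell+1)^m)=(\ell+1,\dots,\ell+1)$ ($m$ entries) and $\mu=(\ell^{m-1},0)=(\ell,\dots,\ell,0)$ ($m-1$ entries equal to $\ell$ followed by one $0$), both of which belong to $\mathcal{P}_{m,\ell}$, and let $\mathring\lambda$ and $\mathring\mu$ be the corresponding cylindric diagrams in $\mathbb{Z}^2/\mathbb{Z}(m,-\ell)$. Then $$f^{\mathring\lambda/\mathring\mu}=\binom{\ell+m-2}{m-1}=g^{\mathring\lambda/\mathring\mu}.$$
   Context: For $m,\ell\in\mathbb{Z}_{\ge1}$ put $\omega=(m,-\ell)$, $\mathcal{C}_\omega=\mathbb{Z}^2/\mathbb{Z}\omega$, and let $\pi:\mathbb{Z}^2\to\mathcal{C}_\omega$ be the projection. $\mathbb{Z}^2$ is partially ordered by $(a,b)\le(a',b')$ iff $a\le a'$ and $b\le b'$; $\mathcal{C}_\omega$ carries the induced partial order: $x\le y$ iff there are $\tilde x\in\pi^{-1}(x)$, $\tilde y\in\pi^{-1}(y)$ with $\tilde x\le\tilde y$. $\mathcal{P}_{m,\ell}$ is the set of integer sequences $\lambda=(\lambda_1,\dots,\lambda_m)$ with $\lambda_1\ge\cdots\ge\lambda_m$ and $\lambda_1-\lambda_m\le\ell$. For $\lambda\in\mathcal{P}_{m,\ell}$ put $\boldsymbol{\lambda}=\{(a,b)\in\mathbb{Z}^2\mid 1\le a\le m,\ b\le\lambda_a\}$, $\hat\lambda=\boldsymbol{\lambda}+\mathbb{Z}\omega$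 (a periodic diagram) and $\mathring\lambda=\pi(\hat\lambda)\subset\mathcal{C}_\omega$ (a cylindric diagram). Let $\lambda,\mu\in\mathcal{P}_{m,\ell}$ with $\mu_i\le\lambda_i$ for all $i$. The cylindric skew diagram is $\mathring\lambda/\mathring\mu=\mathring\lambda\setminus\mathring\mu$, a finite poset with $N=\sum_i(\lambda_i-\mu_i)$ elements. A linear extension of a finite poset $P$ with $N$ elements is a bijection $\varepsilon:P\to\{1,\dots,N\}$ with $x<y\Rightarrow\varepsilon(x)<\varepsilon(y)$. $f^{\mathring\lambda/\mathring\mu}$ is the number of linear extensions of $\mathring\lambda/\mathring\mu$. Excited diagrams: let $D\subset\hat\lambda$ satisfy $D+\omega=D$. A cell $(a,b)\in D$ is $D$-active if $(a+1,b),(a,b+1),(a+1,b+1)\in\hat\lambda\setminus D$. For a $D$-active cell $(a,b)$, the periodic elementary excitation replaces $D$ by $\bigl(D\setminus((a,b)+\mathbb{Z}\omega)\bigr)\cup\bigl((a+1,b+1)+\mathbb{Z}\omega\bigr)$. $\mathcal{E}_{\hat\lambda}(\hat\mu)$ is the set of all subsets of $\hat\lambda$ obtained from $\hat\mu$ by a finite (possibly empty) sequence of periodic elementary excitations at active cells, and $\mathcal{E}_{\mathring\lambda}(\mathring\mu)=\{\pi(D)\mid D\in\mathcal{E}_{\hat\lambda}(\hat\mu)\}$. Hook lengths: for $y\in\hat\lambda$, $h_{\hat\lambda}(y)$ is the number of cells of $\hat\lambda\cap\bigl(\{y+(k,0)\mid k\in\mathbb{Z}_{\ge0}\}\cup\{y+(0,k)\mid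 k\in\mathbb{Z}_{\ge1}\}\bigr)$; for $x\in\mathring\lambda$, $h_{\mathring\lambda}(x)=h_{\hat\lambda}(y)$ for any $y\in\pi^{-1}(x)$ (well defined). Finally, $$g^{\mathring\lambda/\mathring\mu}=N!\sum_{D\in\mathcal{E}_{\mathring\lambda}(\mathring\mu)}\ \prod_{x\in\mathring\lambda\setminus D}\frac{1}{h_{\mathring\lambda}(x)},$$ a (possibly infinite) sum of positive terms. *)

theory Defs
  imports "HOL-Analysis.Infinite_Sum" "HOL-Library.Product_Order" "HOL-Library.Product_Plus"
    "HOL-Library.FuncSet"
begin

text \<open>Throughout, \<open>\<omega> = (m, -l)\<close>. Cells are elements of \<open>int \<times> int\<close>; their order and addition are
  the componentwise ones of the library.\<close>

definition omega_rel :: "nat \<Rightarrow> nat \<Rightarrow> ((int \<times> int) \<times> (int \<times> int)) set" where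
  "omega_rel m l = {(c, c'). \<exists>k::int. c' = c + (k * int m, - k * int l)}"

text \<open>A point of the cylinder is a coset \<open>c + \<int>\<omega>\<close>. The same function therefore serves both as the
  projection \<open>\<pi>\<close> and as the set \<open>c + \<int>\<omega>\<close> of cells.\<close>

definition proj :: "nat \<Rightarrow> nat \<Rightarrow> int \<times> int \<Rightarrow> (int \<times> int) set" where
  "proj m l c = omega_rel m l `` {c}"

definition cyl_le :: "nat \<Rightarrow> nat \<Rightarrow> (int \<times> int) set \<Rightarrow> (int \<times> int) set \<Rightarrow> bool" where
  "cyl_le m l x y \<longleftrightarrow> (\<exists>c d. proj m l c = x \<and> proj m l d = y \<and> c \<le> d)"

definition partitions :: "nat \<Rightarrow> nat \<Rightarrow> int list set" where
  "partitions m l =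
     {lam. length lam = m \<and> sorted_wrt (\<ge>) lam \<and> hd lam - last lam \<le> int l}"

text \<open>Lists are indexed from 0, rows from 1: the part \<open>\<lambda>\<^sub>a\<close> is \<open>lam ! nat (a - 1)\<close>.\<close>

definition strip :: "nat \<Rightarrow> int list \<Rightarrow> (int \<times> int) set" where
  "strip m lam = {(a, b). 1 \<le> a \<and> a \<le> int m \<and> b \<le> lam ! nat (a - 1)}"

definition periodic_diagram :: "nat \<Rightarrow> nat \<Rightarrow> int list \<Rightarrow> (int \<times> int) set" where
  "periodic_diagram m l lam = (\<Union>c\<in>strip m lam. proj m l c)"

definition cyl_diagram :: "nat \<Rightarrow> nat \<Rightarrow> int list \<Rightarrow> (int \<times> int) set set" where
  "cyl_diagram m l lam = proj m l ` periodic_diagram m l lam"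

definition cyl_skew :: "nat \<Rightarrow> nat \<Rightarrow> int list \<Rightarrow> int list \<Rightarrow> (int \<times> int) set set" where
  "cyl_skew m l lam mu = cyl_diagram m l lam - cyl_diagram m l mu"

text \<open>Functions are taken extensional so that each linear extension of \<open>P\<close> is counted once.\<close>

definition linear_extensions :: "('a \<Rightarrow> 'a \<Rightarrow> bool) \<Rightarrow> 'a set \<Rightarrow> ('a \<Rightarrow> nat) set" where
  "linear_extensions le P =
     {e \<in> extensional P. bij_betw e P {1..card P} \<and>
        (\<forall>x\<in>P. \<forall>y\<in>P. le x y \<and> x \<noteq> y \<longrightarrow> e x < e y)}"

definition num_linear_extensions :: "nat \<Rightarrow> nat \<Rightarrow> int list \<Rightarrow> int list \<Rightarrow> nat" where
  "num_linear_extensions m l lam mu =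
     card (linear_extensions (cyl_le m l) (cyl_skew m l lam mu))"

definition active :: "(int \<times> int) set \<Rightarrow> (int \<times> int) set \<Rightarrow> int \<times> int \<Rightarrow> bool" where
  "active L D c \<longleftrightarrow> c \<in> D \<and> {c + (1, 0), c + (0, 1), c + (1, 1)} \<subseteq> L - D"

inductive_set periodic_excited ::
    "nat \<Rightarrow> nat \<Rightarrow> int list \<Rightarrow> int list \<Rightarrow> (int \<times> int) set set"
  for m l :: nat and lam mu :: "int list"
where
  init: "periodic_diagram m l mu \<in> periodic_excited m l lam mu"
| step: "D \<in> periodic_excited m l lam mu \<Longrightarrow> active (periodic_diagram m l lam) D c \<Longrightarrow>
         (D - proj m l c) \<union> proj m l (c + (1, 1)) \<in> periodic_excited m l lam mu"

definition cyl_excited ::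
    "nat \<Rightarrow> nat \<Rightarrow> int list \<Rightarrow> int list \<Rightarrow> (int \<times> int) set set set" where
  "cyl_excited m l lam mu = (\<lambda>D. proj m l ` D) ` periodic_excited m l lam mu"

definition periodic_hook :: "nat \<Rightarrow> nat \<Rightarrow> int list \<Rightarrow> int \<times> int \<Rightarrow> nat" where
  "periodic_hook m l lam y =
     card (periodic_diagram m l lam \<inter>
       ({y + (k, 0) | k. k \<ge> 0} \<union> {y + (0, k) | k. k \<ge> 1}))"

text \<open>The value does not depend on the chosen representative, since \<open>periodic_diagram m l lam\<close> is
  invariant under translation by \<open>\<omega>\<close>.\<close>

definition cyl_hook :: "nat \<Rightarrow> nat \<Rightarrow> int list \<Rightarrow> (int \<times> int) set \<Rightarrow> nat" where
  "cyl_hook m l lam x = periodic_hook m l lam (SOME y. proj m l y = x)"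

definition excited_weight ::
    "nat \<Rightarrow> nat \<Rightarrow> int list \<Rightarrow> (int \<times> int) set set \<Rightarrow> real" where
  "excited_weight m l lam D = (\<Prod>x\<in>cyl_diagram m l lam - D. 1 / real (cyl_hook m l lam x))"

text \<open>The sum may be infinite, and \<open>infsum\<close> is 0 on a divergent family, so a statement about the
  value of \<open>g_sum\<close> should be accompanied by summability of \<open>excited_weight\<close>.\<close>

definition g_sum :: "nat \<Rightarrow> nat \<Rightarrow> int list \<Rightarrow> int list \<Rightarrow> real" where
  "g_sum m l lam mu =
     fact (nat (\<Sum>i<m. lam ! i - mu ! i)) *
       (\<Sum>\<^sub>\<infinity>D\<in>cyl_excited m l lam mu. excited_weight m l lam D)"

end

theory Submission
  imports Defs "HOL-Analysis.Summation_Tests"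
begin

text \<open>The skew diagram is a closed strip around the cylinder with a least and a greatest element, joined
  by two incomparable chains of \<open>m - 1\<close> and \<open>l - 1\<close> elements. A linear extension is thus determined
  by the set of values on one chain.

  The complement of an excited diagram is a periodic lattice path. The hook of \<open>(a, b)\<close> is a function of
  \<open>a\<close> plus a function of \<open>b\<close>, so along every such path the hooks of the inner corners minus the hooks of
  the outer corners add up to \<open>m + l\<close>. Multiplying the weight of a path by \<open>m + l\<close> therefore splits it
  into terms with one corner removed; a path and its neighbour obtained by flipping that corner
  contribute the same term with opposite signs. What survives the cancellation are the paths that
  pass through the cell \<open>(m, 1)\<close>, whose weight is a finite sum over lattice paths in a rectangle, and an
  error term, which tends to \<open>0\<close> because hooks grow at most linearly with the number of
  excitations.\<close>

section \<open>Linear extensions of two chains\<close>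

text \<open>The cylinder lets a rim be pushed inwards forever, so there are infinitely many excited
  diagrams and no last one to induct from. Grading the rims by the number of excitations makes every
  level finite; the cancellation becomes a telescoping between consecutive levels, and the error
  term is what the last level leaves over. The number m + l is the change of
  \<open>col_end b - b\<close> when b drops by l, that is, over one turn around the cylinder. An
  inner corner can be flipped outwards unless this leaves the diagram. Within one period that
  happens only at (0, l + 1), a translate of (m, 1), so the rims that survive are those with an
  inner corner there. Apart from that cell they run inside an m by l rectangle. Hence they are
  finitely many, and their weights without that cell add up to the binomial coefficient over (m + l
  - 1)!. As the skew diagram also has m + l cells, dividing by m + l and multiplying by (m + l)!
  leaves the binomial coefficient.\<close>

lemma card_less_in_image_strict_mono_on:
  fixes h :: "nat \<Rightarrow> 'a::linorder"
  assumes "strict_mono_on {..<n} h" "i < n"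
  shows "card {y \<in> h ` {..<n}. y < h i} = i"
proof -
  have *: "h j < h i \<longleftrightarrow> j < i" if "j < n" for j
    using assms that by (meson lessThan_iff linorder_not_less strict_mono_on_leD strict_mono_on_def)
  have "{y \<in> h ` {..<n}. y < h i} = h ` {..<i}"
    using * assms(2) by auto
  moreover have "inj_on h {..<i}"
    using strict_mono_on_imp_inj_on[OF assms(1)] assms(2) by (auto intro: inj_on_subset)
  ultimately show ?thesis by (simp add: card_image)
qed

text \<open>Both values have rank i in the common image. This is why the set of values on a chain
  determines a linear extension there.\<close>

lemma strict_mono_on_image_unique:
  fixes h h' :: "nat \<Rightarrow> 'a::linorder"
  assumes "strict_mono_on {..<n} h" "strict_mono_on {..<n} h'" "h ` {..<n} = h' ` {..<n}" "i < n"
  shows "h i = h' i"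
proof -
  let ?A = "h ` {..<n}"
  have 1: "card {y \<in> ?A. y < h i} = card {y \<in> ?A. y < h' i}"
    using card_less_in_image_strict_mono_on[OF assms(1,4)]
      card_less_in_image_strict_mono_on[OF assms(2,4)] assms(3) by simp
  have lt: "card {y \<in> ?A. y < u} < card {y \<in> ?A. y < v}" if "u < v" "u \<in> ?A" for u v
    by (rule psubset_card_mono) (use that in auto)
  have "h i \<in> ?A" "h' i \<in> ?A" using assms(3,4) by auto
  then show ?thesis
    using 1 lt[of "h i" "h' i"] lt[of "h' i" "h i"] by (cases "h i" "h' i" rule: linorder_cases) auto
qed

text \<open>Index 0 is the least element, p + q + 1 the greatest, and 1..p and p + 1..p + q are the
  two chains. The indexing is itself a linear extension, so the order is i < j with the pairs across
  the chains struck out.\<close>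

lemma card_linear_extensions_two_chains:
  fixes c :: "nat \<Rightarrow> 'a" and p q :: nat
  assumes inj: "inj_on c {..<p + q + 2}"
    and le: "\<And>i j. i < p + q + 2 \<Longrightarrow> j < p + q + 2 \<Longrightarrow> i \<noteq> j \<Longrightarrow>
      le (c i) (c j) \<longleftrightarrow> i < j \<and> \<not> (1 \<le> i \<and> i \<le> p \<and> p < j \<and> j \<le> p + q)"
  shows "card (linear_extensions le (c ` {..<p + q + 2})) = (p + q) choose p"
proof -
  define n where "n = p + q + 2"
  define P where "P = c ` {..<n}"
  define X where "X = (\<lambda>i. c (Suc i)) ` {..<p}"
  define Y where "Y = (\<lambda>i. c (Suc p + i)) ` {..<q}"
  have cardP: "card P = n"
    using inj by (simp add: P_def n_def card_image)
  have c_eq: "c i = c j \<longleftrightarrow> i = j" if "i < n" "j < n" for i j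
    using inj that by (auto simp: inj_on_def n_def)
  have idx: "i = 0 \<or> i = n - 1 \<or> (\<exists>k<p. i = Suc k) \<or> (\<exists>k<q. i = Suc p + k)" if "i < n" for i
  proof -
    have "i = 0 \<or> i = n - 1 \<or> (1 \<le> i \<and> i \<le> p) \<or> (Suc p \<le> i \<and> i \<le> p + q)"
      using that n_def by auto
    then consider "i = 0" | "i = n - 1" | "1 \<le> i" "i \<le> p" | "Suc p \<le> i" "i \<le> p + q" by blast
    then show ?thesis
    proof cases
      case 3
      then have "i - 1 < p" "i = Suc (i - 1)" by auto
      then show ?thesis by blast
    next
      case 4
      then have "i - Suc p < q" "i = Suc p + (i - Suc p)" by auto
      then show ?thesis by blast
    qed auto
  qed
  have P_split: "P = {c 0, c (n - 1)} \<union> X \<union> Y"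
  proof
    show "P \<subseteq> {c 0, c (n - 1)} \<union> X \<union> Y"
      using idx by (fastforce simp: P_def X_def Y_def)
    show "{c 0, c (n - 1)} \<union> X \<union> Y \<subseteq> P"
      by (auto simp: P_def X_def Y_def n_def)
  qed
  have disj: "X \<inter> Y = {}" "c 0 \<notin> X" "c 0 \<notin> Y" "c (n-1) \<notin> X" "c (n-1) \<notin> Y" "c 0 \<noteq> c (n-1)"
    using c_eq by (auto simp: X_def Y_def n_def)
  have cardX: "card X = p"
    unfolding X_def by (subst card_image) (use c_eq in \<open>auto simp: inj_on_def n_def\<close>)
  have le': "le (c i) (c j) \<longleftrightarrow> i < j \<and> \<not> (1 \<le> i \<and> i \<le> p \<and> p < j \<and> j \<le> p + q)"
    if "i < n" "j < n" "i \<noteq> j" for i j using le that n_def by blast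
  have LE: "linear_extensions le P = {e \<in> extensional P. bij_betw e P {1..n} \<and>
      (\<forall>i<n. \<forall>j<n. i < j \<and> \<not> (1 \<le> i \<and> i \<le> p \<and> p < j \<and> j \<le> p + q) \<longrightarrow> e (c i) < e (c j))}"
    unfolding linear_extensions_def cardP using c_eq le' by (auto simp: P_def)
  \<comment> \<open>The values 1 and n are forced onto the two extreme elements, so the chains share
    out the rest and the values on \<open>Y\<close> are the complement of those on
    \<open>X\<close>.\<close>
  have mid: "e ` X \<union> e ` Y = {2..n-1} \<and> e ` X \<inter> e ` Y = {} \<and> e (c 0) = 1 \<and> e (c (n-1)) = n"
    if "e \<in> linear_extensions le P" for e
  proof -
    from that have bij: "bij_betw e P {1..n}"
      and mono: "\<And>i j. i < j \<Longrightarrow> j < n \<Longrightarrow> \<not> (1 \<le> i \<and> i \<le> p \<and> p < j \<and> j \<le> p + q) \<Longrightarrow> e (c i) < e (c j)"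
      unfolding LE by auto
    have img: "e ` P = {1..n}" using bij by (rule bij_betw_imp_surj_on)
    obtain i where i: "i < n" "e (c i) = 1"
      using img n_def unfolding P_def by (metis (mono_tags, lifting) add_gr_0 atLeastAtMost_iff imageE leI lessThan_iff less_one not_less_zero zero_less_numeral order_refl)
    have "i = 0"
    proof (rule ccontr)
      assume "i \<noteq> 0"
      then have "e (c 0) < e (c i)" using mono[of 0 i] i by auto
      moreover have "e (c 0) \<ge> 1" using img i by (force simp: P_def)
      ultimately show False using i by auto
    qed
    then have b: "e (c 0) = 1" using i by simp
    obtain j where j: "j < n" "e (c j) = n"
      using img n_def unfolding P_def by (metis (no_types, lifting) One_nat_def Suc_leI add_2_eq_Suc' atLeastAtMost_iff imageE lessThan_iff order_refl zero_less_Suc)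
    have "j = n - 1"
    proof (rule ccontr)
      assume "j \<noteq> n - 1"
      then have "e (c j) < e (c (n-1))" using mono[of j "n-1"] j by (auto simp: n_def)
      moreover have "e (c (n-1)) \<le> n" using img j by (force simp: P_def)
      ultimately show False using j by auto
    qed
    then have t: "e (c (n-1)) = n" using j by simp
    have injP: "inj_on e P" using bij by (rule bij_betw_imp_inj_on)
    have sub: "X \<subseteq> P" "Y \<subseteq> P" using P_split by auto
    have "e ` (P - {c 0, c (n-1)}) = e ` P - e ` {c 0, c (n-1)}"
      by (rule inj_on_image_set_diff[OF injP]) (use P_split in auto)
    moreover have "P - {c 0, c (n-1)} = X \<union> Y" using P_split disj by auto
    moreover have "{1..n} - {1, n} = {2..n-1}" by auto
    ultimately have "e ` (X \<union> Y) = {2..n-1}" using img b t by simp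
    moreover have "e ` X \<inter> e ` Y = {}"
      using inj_on_image_Int[OF injP sub] disj by simp
    ultimately show ?thesis using b t by (simp add: image_Un)
  qed
  have compl: "B = S - A" if "A \<union> B = S" "A \<inter> B = {}" for A B S :: "nat set"
    using that by blast
  have "bij_betw (\<lambda>e. e ` X) (linear_extensions le P) {A. A \<subseteq> {2..n-1} \<and> card A = p}"
    unfolding bij_betw_def
  proof
    have monoX: "strict_mono_on {..<p} (\<lambda>i. e (c (Suc i)))"
      and monoY: "strict_mono_on {..<q} (\<lambda>i. e (c (Suc p + i)))"
      if "e \<in> linear_extensions le P" for e
      using that unfolding LE strict_mono_on_def by (auto simp: n_def)
    show "inj_on (\<lambda>e. e ` X) (linear_extensions le P)"
    proof (rule inj_onI)
      fix e e' assume e: "e \<in> linear_extensions le P" and e': "e' \<in> linear_extensions le P"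
        and eq: "e ` X = e' ` X"
      have "e ` Y = {2..n-1} - e ` X" "e' ` Y = {2..n-1} - e' ` X"
        using mid[OF e] mid[OF e'] compl by metis+
      then have eqY: "e ` Y = e' ` Y" using eq by simp
      have "e (c (Suc i)) = e' (c (Suc i))" if "i < p" for i
        using strict_mono_on_image_unique[OF monoX[OF e] monoX[OF e'] _ that] eq
        by (simp add: X_def image_image)
      moreover have "e (c (Suc p + i)) = e' (c (Suc p + i))" if "i < q" for i
        using strict_mono_on_image_unique[OF monoY[OF e] monoY[OF e'] _ that] eqY
        by (simp add: Y_def image_image)
      moreover have "e (c 0) = e' (c 0)" "e (c (n-1)) = e' (c (n-1))"
        using mid[OF e] mid[OF e'] by simp_all
      ultimately have "e x = e' x" if "x \<in> P" for x
        using that unfolding P_split X_def Y_def by blast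
      moreover have "e \<in> extensional P" "e' \<in> extensional P"
        using e e' by (auto simp: linear_extensions_def)
      ultimately show "e = e'" by (rule extensionalityI[rotated 2])
    qed
    show "(\<lambda>e. e ` X) ` linear_extensions le P = {A. A \<subseteq> {2..n-1} \<and> card A = p}"
    proof (intro equalityI subsetI)
      fix A assume "A \<in> (\<lambda>e. e ` X) ` linear_extensions le P"
      then obtain e where e: "e \<in> linear_extensions le P" "A = e ` X" by blast
      have "inj_on e P" using e by (auto simp: linear_extensions_def bij_betw_def)
      then have "inj_on e X" using P_split by (auto intro: inj_on_subset)
      then show "A \<in> {A. A \<subseteq> {2..n-1} \<and> card A = p}"
        using mid[OF e(1)] e(2) cardX by (auto simp: card_image)
    next
      fix A assume "A \<in> {A. A \<subseteq> {2..n-1} \<and> card A = p}"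
      then have A: "A \<subseteq> {2..n-1}" "card A = p" by auto
      then have finA: "finite A" by (meson finite_atLeastAtMost finite_subset)
      define B where "B = {2..n-1} - A"
      have finB: "finite B" by (simp add: B_def)
      have cardB: "card B = q"
        using A finA by (simp add: B_def card_Diff_subset n_def)
      obtain g where g: "bij_betw g {..<p} A" "strict_mono_on {..<p} g"
        using ex_bij_betw_strict_mono_card[OF finA] A by metis
      obtain h where h: "bij_betw h {..<q} B" "strict_mono_on {..<q} h"
        using ex_bij_betw_strict_mono_card[OF finB] cardB by metis
      \<comment> \<open>Inverse construction: \<open>A\<close> is listed increasingly along the
        first chain and its complement \<open>B\<close> along the second.\<close>
      define d where "d i = (if i = 0 then 1 else if i \<le> p then g (i - 1)
        else if i \<le> p + q then h (i - Suc p) else n)" for i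
      define e where "e = restrict (\<lambda>x. d (the_inv_into {..<n} c x)) P"
      have ec: "e (c i) = d i" if "i < n" for i
        using that inj by (auto simp: e_def P_def n_def the_inv_into_f_f)
      have gA: "g i \<in> A" if "i < p" for i using g(1) that by (auto simp: bij_betw_def)
      have hB: "h i \<in> B" if "i < q" for i using h(1) that by (auto simp: bij_betw_def)
      have d_g: "d (Suc i) = g i" if "i < p" for i using that by (simp add: d_def)
      have d_h: "d (Suc p + i) = h i" if "i < q" for i using that by (simp add: d_def)
      have eX: "e ` X = A"
        using g(1) ec d_g by (auto simp: X_def n_def bij_betw_def image_image)
      have eY: "e ` Y = B"
      proof -
        have "e ` Y = h ` {..<q}"
          unfolding Y_def image_image using ec d_h by (intro image_cong) (auto simp: n_def)
        then show ?thesis using h(1) by (simp add: bij_betw_def)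
      qed
      have e0: "e (c 0) = 1" "e (c (n-1)) = n" 
        using ec[of 0] ec[of "n-1"] by (auto simp: d_def n_def)
      have "e ` P = {1, n} \<union> A \<union> B"
        unfolding P_split using eX eY e0 by (simp add: image_Un)
      also have "\<dots> = {1..n}" using A by (auto simp: B_def n_def)
      finally have img: "e ` P = {1..n}" .
      then have "bij_betw e P {1..n}"
        using cardP by (metis P_def bij_betw_def card_atLeastAtMost diff_Suc_1 eq_card_imp_inj_on finite_imageI finite_lessThan)
      moreover have "d i < d j" if ij: "i < j" "j < n" "\<not> (1 \<le> i \<and> i \<le> p \<and> p < j \<and> j \<le> p + q)" for i j
      proof -
        have range: "2 \<le> d k \<and> d k \<le> n - 1" if "0 < k" "k < n - 1" for k
        proof -
          from idx[of k] that consider k' where "k' < p" "k = Suc k'" | k' where "k' < q" "k = Suc p + k'"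
            by (auto simp: n_def)
          then show ?thesis
          proof cases
            case 1 then show ?thesis using gA[of k'] A d_g by auto
          next
            case 2 then show ?thesis using hB[of k'] d_h by (auto simp: B_def)
          qed
        qed
        have "i = 0 \<or> j = n - 1 \<or> (1 \<le> i \<and> j \<le> p) \<or> (p < i \<and> j \<le> p + q)"
          using ij by (auto simp: n_def)
        then consider "i = 0" | "i \<noteq> 0" "j = n - 1" | "1 \<le> i" "j \<le> p" | "p < i" "j \<le> p + q" by blast
        then show ?thesis
        proof cases
          case 1
          then have "d i = 1" by (simp add: d_def)
          moreover have "d j \<ge> 2"
            using range[of j] ij 1 by (cases "j = n - 1") (auto simp: d_def n_def)
          ultimately show ?thesis by simp
        next
          case 2
          then have "d j = n" by (simp add: d_def n_def)
          moreover have "d i \<le> n - 1" using range[of i] 2 ij by auto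
          ultimately show ?thesis by (simp add: n_def)
        next
          case 3
          then have "g (i - 1) < g (j - 1)"
            using ij by (intro strict_mono_onD[OF g(2)]) auto
          then show ?thesis using 3 ij by (simp add: d_def)
        next
          case 4
          then have "h (i - Suc p) < h (j - Suc p)"
            using ij by (intro strict_mono_onD[OF h(2)]) auto
          then show ?thesis using 4 ij by (simp add: d_def)
        qed
      qed
      ultimately have "e \<in> linear_extensions le P"
        unfolding LE using ec by (auto simp: e_def)
      then show "A \<in> (\<lambda>e. e ` X) ` linear_extensions le P" using eX by blast
    qed
  qed
  then have "card (linear_extensions le P) = card {A. A \<subseteq> {2..n-1} \<and> card A = p}"
    by (rule bij_betw_same_card)
  also have "\<dots> = card {2..n-1} choose p" by (rule n_subsets) simp
  finally show ?thesis by (simp add: P_def n_def)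
qed

section \<open>Series\<close>

text \<open>If the error term had a positive limit, the terms \<open>w n\<close> would dominate a multiple of the
  harmonic series.\<close>

lemma sums_of_telescoping_with_error:
  fixes w e :: "nat \<Rightarrow> real"
  assumes w: "\<And>n. 0 \<le> w n" and e: "\<And>n. 0 \<le> e n" "\<And>n. e n \<le> K * (real n + 1) * w n"
    and c: "c > 0" and tel: "\<And>n. n \<ge> n0 \<Longrightarrow> c * (\<Sum>k\<le>n. w k) + e n = S"
  shows "w sums (S / c)"
proof -
  have "(\<Sum>k\<le>n. w k) \<le> S / c" for n
  proof -
    \<comment> \<open>The identity is available only from \<open>n0\<close> on; as the terms are
      nonnegative, n may be enlarged.\<close>
    have "(\<Sum>k\<le>n. w k) \<le> (\<Sum>k\<le>max n n0. w k)" by (intro sum_mono2) (auto simp: w)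
    also have "\<dots> \<le> S / c"
      using tel[of "max n n0"] e(1)[of "max n n0"] c by (simp add: field_simps)
    finally show ?thesis .
  qed
  then have summ: "summable w" by (intro bounded_imp_summable) (auto simp: w)
  then have lim: "(\<lambda>n. \<Sum>k\<le>n. w k) \<longlonglongrightarrow> suminf w"
    by (rule summable_LIMSEQ')
  define L where "L = S - c * suminf w"
  have "(\<lambda>n. S - c * (\<Sum>k\<le>n. w k)) \<longlonglongrightarrow> L"
    unfolding L_def by (intro tendsto_intros lim)
  moreover have "\<forall>\<^sub>F n in sequentially. S - c * (\<Sum>k\<le>n. w k) = e n"
    using tel by (auto simp: eventually_sequentially algebra_simps intro!: exI[of _ n0])
  ultimately have eL: "e \<longlonglongrightarrow> L" by (rule Lim_transform_eventually)
  have "L \<ge> 0" using eL by (rule LIMSEQ_le_const) (auto simp: e)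
  moreover have "\<not> L > 0"
  proof
    assume "L > 0"
    define K' where "K' = max K 1"
    have K': "K' > 0" by (simp add: K'_def)
    have eK': "e n \<le> K' * (real n + 1) * w n" for n
    proof -
      have "K * (real n + 1) * w n \<le> K' * (real n + 1) * w n"
        by (intro mult_right_mono) (auto simp: K'_def w)
      then show ?thesis using e(2)[of n] by linarith
    qed
    have "\<forall>\<^sub>F n in sequentially. e n > L / 2"
      using eL \<open>L > 0\<close> by (intro order_tendstoD) auto
    then have "\<forall>\<^sub>F n in sequentially. norm (inverse (real (Suc n))) \<le> (2 * K' / L) * w n"
    proof eventually_elim
      case (elim n)
      then have "L / 2 < K' * (real n + 1) * w n" using eK'[of n] by linarith
      then show ?case using \<open>L > 0\<close> by (simp add: field_simps)
    qed
    then have "summable (\<lambda>n. inverse (real (Suc n)))"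
      by (rule summable_comparison_test_ev) (intro summable_mult summ)
    then show False
      using not_summable_harmonic[where 'a = real] summable_Suc_iff[of "\<lambda>n. inverse (real n)"] by simp
  qed
  ultimately have "S / c = suminf w" using c by (simp add: L_def field_simps)
  then show ?thesis using summ by (simp add: summable_sums)
qed

text \<open>A finite subset meets only finitely many blocks, so its sum is at most a partial sum of
  the series; conversely each partial sum is the sum over a finite set. Nonnegativity turns these
  bounds into an unordered sum.\<close>

lemma has_sum_UNION_nat:
  fixes f :: "'a \<Rightarrow> real"
  assumes "disjoint_family A" "\<And>n. finite (A n)" "\<And>x. f x \<ge> 0"
    and sums: "(\<lambda>n. sum f (A n)) sums S"
  shows "(f has_sum S) (\<Union>n. A n)"
proof -
  have part: "sum f (\<Union>k\<le>n. A k) = (\<Sum>k\<le>n. sum f (A k))" for n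
    using assms(1,2) by (intro sum.UNION_disjoint) (auto simp: disjoint_family_on_def)
  have part_le: "(\<Sum>k\<le>n. sum f (A k)) \<le> S" for n
    using sums sum_le_suminf[of "\<lambda>n. sum f (A n)" "{..n}"] assms(3)
    by (auto simp: sums_iff sum_nonneg)
  have bound: "sum f F \<le> S" if F: "finite F" "F \<subseteq> (\<Union>n. A n)" for F
  proof -
    obtain idx where idx: "\<And>x. x \<in> F \<Longrightarrow> x \<in> A (idx x)" using F(2) by (metis UN_E subsetD)
    obtain N where "\<And>x. x \<in> F \<Longrightarrow> idx x \<le> N"
      using finite_nat_set_iff_bounded_le[of "idx ` F"] F(1) by auto
    then have "F \<subseteq> (\<Union>k\<le>N. A k)" using idx by blast
    then have "sum f F \<le> sum f (\<Union>k\<le>N. A k)"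
      using assms(2,3) by (intro sum_mono2) auto
    then show ?thesis using part part_le[of N] by simp
  qed
  have summ: "f summable_on (\<Union>n. A n)"
    by (rule nonneg_bdd_above_summable_on) (use bound assms(3) in \<open>auto intro!: bdd_aboveI2[where M = S]\<close>)
  then have hs: "(f has_sum infsum f (\<Union>n. A n)) (\<Union>n. A n)" by (rule has_sum_infsum)
  have "infsum f (\<Union>n. A n) \<le> S" using hs bound by (rule has_sum_le_finite_sums)
  moreover have "S \<le> infsum f (\<Union>n. A n)"
  proof (rule LIMSEQ_le_const2)
    show "(\<lambda>n. \<Sum>k\<le>n. sum f (A k)) \<longlonglongrightarrow> S" using sums by (simp add: sums_def_le)
    have "(\<Sum>k\<le>n. sum f (A k)) \<le> infsum f (\<Union>n. A n)" for n
      unfolding part[symmetric] using assms(2,3) by (intro finite_sum_le_infsum[OF summ]) auto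
    then show "\<exists>N. \<forall>n\<ge>N. (\<Sum>k\<le>n. sum f (A k)) \<le> infsum f (\<Union>n. A n)" by blast
  qed
  ultimately have "infsum f (\<Union>n. A n) = S" by (rule antisym)
  with hs show ?thesis by (simp only:)
qed

section \<open>Lattice paths in a rectangle\<close>

text \<open>In the coordinates \<open>i = a - 1\<close> and \<open>d = l + 1 - b\<close>, a staircase is a lattice path in the rectangle
  of rows \<open>1, \<dots>, m\<close> and columns \<open>2, \<dots>, l + 1\<close>, on which the hook of \<open>(a, b)\<close> is \<open>(m - i) + d\<close>.\<close>

definition staircases :: "nat \<Rightarrow> nat \<Rightarrow> (nat \<Rightarrow> nat) set" where
  "staircases k j = {g. mono g \<and> g 0 = 0 \<and> (\<forall>i\<ge>k. g i = j)}"

text \<open>Consecutive ranges overlap in one column, because a vertical step joins two cells of the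
  same column. \<open>k\<close> counts the rows used so far while \<open>m\<close> stays fixed in
  the hooks, which allows induction on \<open>k\<close>.\<close>

definition staircase_weight :: "nat \<Rightarrow> nat \<Rightarrow> (nat \<Rightarrow> nat) \<Rightarrow> real" where
  "staircase_weight m k g = (\<Prod>i<k. \<Prod>d = g i..g (Suc i). 1 / (real (m - i) + real d))"

lemma staircases_0: "staircases 0 j = (if j = 0 then {\<lambda>_. 0} else {})"
  by (auto simp: staircases_def mono_def)

text \<open>Cuts off the last row: what remains of the path ends in column \<open>g k\<close>, so
  its constant tail must be reset to that value.\<close>

lemma staircases_Suc_bij:
  "bij_betw (\<lambda>g. (g k, \<lambda>i. if k \<le> i then g k else g i)) (staircases (Suc k) j) (SIGMA i:{..j}. staircases k i)"
proof (rule bij_betw_byWitness[where f' = "\<lambda>(c, g) i. if Suc k \<le> i then j else g i"])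
  show "\<forall>g\<in>staircases (Suc k) j. (\<lambda>(c, g) i. if Suc k \<le> i then j else g i)
      (g k, \<lambda>i. if k \<le> i then g k else g i) = g"
    by (auto simp: staircases_def fun_eq_iff not_less_eq_eq le_antisym)
  show "\<forall>x\<in>SIGMA i:{..j}. staircases k i. (\<lambda>g. (g k, \<lambda>i. if k \<le> i then g k else g i))
      ((\<lambda>(c, g) i. if Suc k \<le> i then j else g i) x) = x"
    by (auto simp: staircases_def fun_eq_iff)
  show "(\<lambda>g. (g k, \<lambda>i. if k \<le> i then g k else g i)) ` staircases (Suc k) j
      \<subseteq> (SIGMA i:{..j}. staircases k i)"
  proof clarify
    fix g assume g: "g \<in> staircases (Suc k) j"
    then have "g k \<le> g (Suc k)" by (auto simp: staircases_def mono_def)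
    then have "g k \<le> j" using g by (simp add: staircases_def)
    moreover have "g 0 = 0" "mono g" using g by (auto simp: staircases_def)
    ultimately show "g k \<in> {..j} \<and> (\<lambda>i. if k \<le> i then g k else g i) \<in> staircases k (g k)"
      by (auto simp: staircases_def mono_def)
  qed
  show "(\<lambda>(c, g) i. if Suc k \<le> i then j else g i) ` (SIGMA i:{..j}. staircases k i)
      \<subseteq> staircases (Suc k) j"
  proof (rule image_subsetI)
    fix x assume "x \<in> (SIGMA i:{..j}. staircases k i)"
    then obtain c g where x: "x = (c, g)" and "c \<in> {..j}" and g: "g \<in> staircases k c" by blast
    have "g i \<le> j" for i
    proof -
      have "g i \<le> g (max i k)" using g by (intro monoD[of g]) (auto simp: staircases_def)
      also have "\<dots> = c" using g by (simp add: staircases_def)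
      finally show ?thesis using \<open>c \<in> {..j}\<close> by simp
    qed
    then show "(\<lambda>(c, g) i. if Suc k \<le> i then j else g i) x \<in> staircases (Suc k) j"
      using g unfolding x by (auto simp: staircases_def mono_def)
  qed
qed

lemma finite_staircases: "finite (staircases k j)"
proof (induction k arbitrary: j)
  case (Suc k)
  then show ?case
    using bij_betw_finite[OF staircases_Suc_bij[of k j]] by simp
qed (simp add: staircases_0)

lemma sum_staircases_Suc:
  "(\<Sum>g\<in>staircases (Suc k) j. staircase_weight m (Suc k) g) =
    (\<Sum>i\<le>j. (\<Sum>g\<in>staircases k i. staircase_weight m k g) * (\<Prod>d = i..j. 1 / (real (m - k) + real d)))"
proof -
  let ?F = "\<lambda>(c, g). staircase_weight m k g * (\<Prod>d = c..j. 1 / (real (m - k) + real d))"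
  have "(\<Sum>g\<in>staircases (Suc k) j. staircase_weight m (Suc k) g) =
      (\<Sum>g\<in>staircases (Suc k) j. ?F (g k, \<lambda>i. if k \<le> i then g k else g i))"
  proof (intro sum.cong refl)
    fix g assume g: "g \<in> staircases (Suc k) j"
    have "(if k \<le> Suc i then g k else g (Suc i)) = g (Suc i)" if "i < k" for i
      using that by (cases "Suc i = k") auto
    then have "staircase_weight m k (\<lambda>i. if k \<le> i then g k else g i) = staircase_weight m k g"
      unfolding staircase_weight_def by (intro prod.cong refl) (simp only: lessThan_iff not_le if_not_P)
    moreover have "g (Suc k) = j" using g by (simp add: staircases_def)
    ultimately show "staircase_weight m (Suc k) g = ?F (g k, \<lambda>i. if k \<le> i then g k else g i)"
      by (simp add: staircase_weight_def)
  qed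
  also have "\<dots> = sum ?F (SIGMA i:{..j}. staircases k i)"
    by (rule sum.reindex_bij_betw[OF staircases_Suc_bij])
  finally show ?thesis
    by (simp add: sum.Sigma[symmetric] finite_staircases sum_distrib_right)
qed

text \<open>The denominator is the hook of the last cell. Deleting that cell leaves a path ending
  one column earlier in the same row or one row earlier in the same column.\<close>

lemma sum_staircases_Suc_Suc:
  "(\<Sum>g\<in>staircases (Suc k) (Suc j). staircase_weight m (Suc k) g) =
    ((\<Sum>g\<in>staircases (Suc k) j. staircase_weight m (Suc k) g) +
     (\<Sum>g\<in>staircases k (Suc j). staircase_weight m k g)) / (real (m - k) + real (Suc j))"
proof -
  \<comment> \<open>For i = Suc j the remaining product is empty; that summand belongs to the paths
    arriving from the row above.\<close>
  have "(\<Prod>d = i..Suc j. 1 / (real (m - k) + real d)) =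
      (\<Prod>d = i..j. 1 / (real (m - k) + real d)) / (real (m - k) + real (Suc j))" if "i \<le> Suc j" for i
    using that by (subst prod.nat_ivl_Suc') auto
  then show ?thesis
    unfolding sum_staircases_Suc
    by (simp add: sum_distrib_right add_divide_distrib sum_divide_distrib)
qed

lemma binomial_absorb_step: "j * (n choose j) = (n + 1 - j) * (n choose (j - 1))" if j: "j \<ge> 1"
proof -
  obtain i where "j = Suc i" using j by (cases j) auto
  moreover have "Suc i * (n choose Suc i) = (n - i) * (n choose i)"
    by (metis binomial_absorb_comp binomial_absorption mult.commute diff_Suc_1)
  ultimately show ?thesis by simp
qed

text \<open>The sum is what it would be if each of the (k + j choose j) paths had the hooks m - k,
  ..., m + j. Single paths do not, but this closed form satisfies the recursion that deletes the
  last cell.\<close>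

lemma sum_staircases:
  assumes "k < m"
  shows "(\<Sum>g\<in>staircases (Suc k) j. staircase_weight m (Suc k) g) =
    fact (m - Suc k) * real ((k + j) choose j) / fact (m + j)"
  using assms
proof (induction k arbitrary: j)
  case 0
  show ?case
  proof (induction j)
    case 0
    then show ?case using \<open>0 < m\<close>
      unfolding sum_staircases_Suc by (simp add: staircases_0 staircase_weight_def fact_reduce)
  next
    case (Suc j)
    then show ?case
      by (simp add: sum_staircases_Suc_Suc staircases_0)
  qed
next
  case (Suc k)
  note IH = Suc.IH
  show ?case
  proof (induction j)
    case 0
    have "(\<Sum>g\<in>staircases (Suc (Suc k)) 0. staircase_weight m (Suc (Suc k)) g) =
        (fact (m - Suc k) / fact m) / real (m - Suc k)"
      unfolding sum_staircases_Suc[where k = "Suc k"] using Suc.IH[of 0] Suc.prems by simp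
    also have "fact (m - Suc k) = real (m - Suc k) * fact (m - Suc (Suc k))"
      using Suc.prems by (subst fact_reduce) (auto simp: Suc_diff_Suc)
    finally show ?case using Suc.prems by simp
  next
    case (Suc j)
    define i where "i = m - Suc (Suc k)"
    have m: "m = i + Suc (Suc k)" using \<open>Suc k < m\<close> by (simp add: i_def)
    have i: "m - Suc k = Suc i" using m by simp
    define A where "A = real ((Suc k + j) choose j)"
    define B where "B = real ((Suc k + j) choose Suc j)"
    have ab: "(real j + 1) * B = (real k + 1) * A"
    proof -
      have "Suc j * ((Suc k + j) choose Suc j) = Suc k * ((Suc k + j) choose j)"
        using binomial_absorb_step[of "Suc j" "Suc k + j"] by simp
      then have "real (Suc j * ((Suc k + j) choose Suc j)) = real (Suc k * ((Suc k + j) choose j))"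
        by (simp only:)
      then show ?thesis by (simp add: A_def B_def algebra_simps)
    qed
    define M where "M = real m + real j + 1"
    have "M > 0" by (simp add: M_def)
    have M_fact: "fact (m + Suc j) = M * fact (m + j)" by (simp add: M_def algebra_simps)
    have pascal: "real ((Suc k + Suc j) choose Suc j) = A + B"
      by (simp add: A_def B_def)
    have "(\<Sum>g\<in>staircases (Suc (Suc k)) (Suc j). staircase_weight m (Suc (Suc k)) g) =
      (fact i * A / fact (m + j) + fact (Suc i) * B / fact (m + Suc j)) / (real (Suc i) + real (Suc j))"
    proof -
      have "(\<Sum>g\<in>staircases (Suc (Suc k)) j. staircase_weight m (Suc (Suc k)) g) = fact i * A / fact (m + j)"
        using Suc.IH by (simp add: A_def i_def)
      moreover have "(\<Sum>g\<in>staircases (Suc k) (Suc j). staircase_weight m (Suc k) g) =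
          fact (Suc i) * B / fact (m + Suc j)"
        using IH[of "Suc j"] \<open>Suc k < m\<close> i by (simp add: B_def)
      ultimately show ?thesis
        unfolding sum_staircases_Suc_Suc[where k = "Suc k"] i by simp
    qed
    also have "fact i * A / fact (m + j) + fact (Suc i) * B / fact (m + Suc j) =
        fact i * (M * A + (real i + 1) * B) / fact (m + Suc j)"
    proof -
      have "A / fact (m + j) = M * A / fact (m + Suc j)"
        unfolding M_fact using \<open>M > 0\<close> by simp
      then have "fact i * A / fact (m + j) = fact i * (M * A) / fact (m + Suc j)"
        by (metis times_divide_eq_right)
      moreover have "fact (Suc i) * B = fact i * ((real i + 1) * B)" by simp
      ultimately show ?thesis by (simp only: distrib_left add_divide_distrib)
    qed
    \<comment> \<open>\<open>M\<close> exceeds the hook i + j + 2 of the last cell by k + 1. By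
      \<open>ab\<close> the surplus (k + 1) * A equals (j + 1) * B, which completes (i + 1) * B to
      the hook times B.\<close>
    also have "M * A + (real i + 1) * B = (real (Suc i) + real (Suc j)) * (A + B)"
      using ab by (simp add: M_def m algebra_simps)
    finally show ?case using pascal by (simp add: i_def)
  qed
qed

section \<open>Hooks and excited diagrams on the cylinder\<close>

lemma le_div_iff_mult_le_int:
  fixes a b k :: int
  assumes "k > 0"
  shows "a \<le> b div k \<longleftrightarrow> a * k \<le> b"
proof
  assume "a \<le> b div k"
  then have "a * k \<le> (b div k) * k" using assms by simp
  also have "\<dots> \<le> b"
    using pos_mod_sign[OF assms, of b] div_mult_mod_eq[of b k] by linarith
  finally show "a * k \<le> b" .
next
  assume "a * k \<le> b"
  then have "(a * k) div k \<le> b div k" using assms by (intro zdiv_mono1)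
  then show "a \<le> b div k" using assms by simp
qed

lemma mem_proj_iff: "(a', b') \<in> proj m l (a, b) \<longleftrightarrow> (\<exists>k. a' = a + k * int m \<and> b' = b - k * int l)"
  by (auto simp: proj_def omega_rel_def)

lemma proj_translate: "proj m l (a + k * int m, b - k * int l) = proj m l (a, b)"
proof -
  have "\<exists>k'. a + k * int m + j * int m = a + k' * int m \<and>
      b - k * int l - j * int l = b - k' * int l" for j
    by (rule exI[of _ "k + j"]) (auto simp: algebra_simps)
  moreover have "\<exists>k'. a + j * int m = a + k * int m + k' * int m \<and>
      b - j * int l = b - k * int l - k' * int l" for j
    by (rule exI[of _ "j - k"]) (auto simp: algebra_simps)
  ultimately show ?thesis by (auto simp: mem_proj_iff)
qed

lemma proj_self: "c \<in> proj m l c"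
  by (cases c) (auto simp: mem_proj_iff intro: exI[of _ 0])

lemma proj_eq_iff: "proj m l c = proj m l d \<longleftrightarrow> d \<in> proj m l c"
proof
  show "proj m l c = proj m l d \<Longrightarrow> d \<in> proj m l c" using proj_self by blast
  show "d \<in> proj m l c \<Longrightarrow> proj m l c = proj m l d"
    by (cases c; cases d) (auto simp: mem_proj_iff proj_translate)
qed

section \<open>Closed forms for row ends, hooks and the two diagrams\<close>

locale cylinder =
  fixes m l :: nat
  assumes m_pos: "m \<ge> 1" and l_pos: "l \<ge> 1"
begin

definition row_end :: "int \<Rightarrow> int" where
  "row_end a = int l + 1 - int l * ((a - 1) div int m)"

definition col_end :: "int \<Rightarrow> int" where
  "col_end b = int m + int m * ((int l + 1 - b) div int l)"

text \<open>An integer formula for arm + leg + 1, so that hooks can be subtracted; it separates as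
  (\<open>row_end a\<close> - a) + (\<open>col_end b\<close> - b) + 1.\<close>

definition hook :: "int \<Rightarrow> int \<Rightarrow> int" where
  "hook a b = (row_end a - b) + (col_end b - a) + 1"

text \<open>The same region read by rows and by columns: two floor functions in a Galois connection.
  It makes \<open>col_end\<close> the leg end of the hooks.\<close>

lemma le_row_end_iff: "b \<le> row_end a \<longleftrightarrow> a \<le> col_end b"
proof -
  have "b \<le> row_end a \<longleftrightarrow> (a - 1) div int m * int l \<le> int l + 1 - b"
    by (auto simp: row_end_def algebra_simps)
  also have "\<dots> \<longleftrightarrow> (a - 1) div int m \<le> (int l + 1 - b) div int l"
    using l_pos by (simp add: le_div_iff_mult_le_int)
  also have "\<dots> \<longleftrightarrow> \<not> (int l + 1 - b) div int l + 1 \<le> (a - 1) div int m" by auto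
  also have "\<dots> \<longleftrightarrow> a - 1 < ((int l + 1 - b) div int l + 1) * int m"
    using m_pos by (subst le_div_iff_mult_le_int) auto
  also have "\<dots> \<longleftrightarrow> a \<le> col_end b"
    by (auto simp: col_end_def algebra_simps)
  finally show ?thesis .
qed

lemma row_end_translate: "row_end (a + k * int m) = row_end a - k * int l"
proof -
  have "(a + k * int m - 1) div int m = k + (a - 1) div int m"
    using m_pos by (metis add_diff_eq add.commute diff_add_eq div_mult_self1 of_nat_eq_0_iff not_one_le_zero)
  then show ?thesis by (simp add: row_end_def algebra_simps)
qed

lemma col_end_translate: "col_end (b - k * int l) = col_end b + k * int m"
proof -
  have "int l + 1 - (b - k * int l) = (int l + 1 - b) + k * int l" by simp
  then have "(int l + 1 - (b - k * int l)) div int l = k + (int l + 1 - b) div int l"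
    using l_pos by (metis div_mult_self1 of_nat_eq_0_iff not_one_le_zero)
  then show ?thesis by (simp add: col_end_def algebra_simps)
qed

lemma hook_translate: "hook (a + k * int m) (b - k * int l) = hook a b"
  by (simp add: hook_def row_end_translate col_end_translate)

lemma row_end_eq: "row_end a = int l + 1" if "1 \<le> a" "a \<le> int m"
  using that by (simp add: row_end_def)

lemma col_end_eq: "col_end b = int m" if "2 \<le> b" "b \<le> int l + 1"
  using that by (simp add: col_end_def)

definition diagram :: "(int \<times> int) set" where
  "diagram = {(a, b). b \<le> row_end a}"

lemma mem_periodic_diagram_iff:
  assumes "length nu = m"
  shows "(a, b) \<in> periodic_diagram m l nu \<longleftrightarrow>
    b \<le> nu ! nat ((a - 1) mod int m) - ((a - 1) div int m) * int l"
proof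
  assume "(a, b) \<in> periodic_diagram m l nu"
  then obtain a' b' k where *: "1 \<le> a'" "a' \<le> int m" "b' \<le> nu ! nat (a' - 1)"
    "a = a' + k * int m" "b = b' - k * int l"
    by (auto simp: periodic_diagram_def strip_def mem_proj_iff)
  have "(a - 1) div int m = k \<and> (a - 1) mod int m = a' - 1"
    using * by (intro conjI int_div_pos_eq int_mod_pos_eq) auto
  then show "b \<le> nu ! nat ((a - 1) mod int m) - ((a - 1) div int m) * int l"
    using * by simp
next
  let ?k = "(a - 1) div int m" and ?a = "(a - 1) mod int m + 1"
  assume "b \<le> nu ! nat ((a - 1) mod int m) - ?k * int l"
  then have "(?a, b + ?k * int l) \<in> strip m nu"
    using m_pos by (auto simp: strip_def zless_imp_add1_zle[OF pos_mod_bound])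
  moreover have "(a, b) \<in> proj m l (?a, b + ?k * int l)"
    using div_mult_mod_eq[of "a - 1" "int m"] by (auto simp: mem_proj_iff intro!: exI[of _ ?k])
  ultimately show "(a, b) \<in> periodic_diagram m l nu"
    unfolding periodic_diagram_def by blast
qed

abbreviation lam :: "int list" where "lam \<equiv> replicate m (int l + 1)"
abbreviation mu :: "int list" where "mu \<equiv> replicate (m - 1) (int l) @ [0]"

lemma periodic_diagram_lam: "periodic_diagram m l lam = diagram"
proof -
  have "nat ((a - 1) mod int m) < m" for a
    using m_pos by (simp add: nat_less_iff)
  then show ?thesis
    by (auto simp: diagram_def row_end_def mem_periodic_diagram_iff algebra_simps)
qed

text \<open>The diagram of \<open>mu\<close> is that of \<open>lam\<close> shifted by (-1, -1), so
  the skew diagram is the rim of \<open>row_end\<close> and the excitations start from the outermost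
  rim.\<close>

lemma periodic_diagram_mu: "periodic_diagram m l mu = {(a, b). b < row_end (a + 1)}"
proof -
  have "(a, b) \<in> periodic_diagram m l mu \<longleftrightarrow> b < row_end (a + 1)" for a b
  proof -
    define q r where "q = (a - 1) div int m" and "r = (a - 1) mod int m"
    have r: "0 \<le> r" "r < int m" and a: "a - 1 = q * int m + r"
      using m_pos by (auto simp: q_def r_def)
    have "mu ! nat r - q * int l = row_end (a + 1) - 1"
    proof (cases "r = int m - 1")
      \<comment> \<open>In the last row of a period the next row already lies l lower, which
        accounts for the entry 0 of \<open>mu\<close>.\<close>
      case True
      then have "a = (q + 1) * int m" using a by (simp add: algebra_simps)
      then have "a div int m = q + 1" using m_pos by simp
      moreover have "nat r = m - 1" using True by simp
      ultimately show ?thesis by (simp add: row_end_def nth_append algebra_simps)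
    next
      case False
      then have "a div int m = q"
        using r a by (intro int_div_pos_eq[of _ _ _ "r + 1"]) (auto simp: algebra_simps)
      moreover have "nat r < m - 1" using r False by auto
      ultimately show ?thesis by (simp add: row_end_def nth_append algebra_simps)
    qed
    then show ?thesis
      using m_pos by (simp add: mem_periodic_diagram_iff q_def r_def)
  qed
  then show ?thesis by auto
qed

lemma periodic_hook_lam:
  assumes "(a, b) \<in> diagram"
  shows "periodic_hook m l lam (a, b) = nat (hook a b)"
proof -
  have b: "b \<le> row_end a" "a \<le> col_end b" using assms le_row_end_iff by (auto simp: diagram_def)
  have "diagram \<inter> ({(a, b) + (k, 0) | k. k \<ge> 0} \<union> {(a, b) + (0, k) | k. k \<ge> 1}) =
      (\<lambda>x. (x, b)) ` {a..col_end b} \<union> (\<lambda>y. (a, y)) ` {b + 1..row_end a}" (is "?A = ?B")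
  proof
    show "?A \<subseteq> ?B" by (auto simp: diagram_def le_row_end_iff image_iff)
    show "?B \<subseteq> ?A"
    proof
      fix c assume "c \<in> ?B"
      then consider x where "c = (x, b)" "a \<le> x" "x \<le> col_end b"
        | y where "c = (a, y)" "b + 1 \<le> y" "y \<le> row_end a" by auto
      then show "c \<in> ?A"
      proof cases
        case 1
        then show ?thesis by (auto simp: diagram_def le_row_end_iff intro: exI[of _ "x - a"])
      next
        case 2
        then show ?thesis by (auto simp: diagram_def intro: exI[of _ "y - b"])
      qed
    qed
  qed
  moreover have "card ?B = nat (hook a b)"
    using b by (subst card_Un_disjoint) (auto simp: card_image inj_on_def hook_def nat_add_distrib[symmetric])
  ultimately show ?thesis by (simp add: periodic_hook_def periodic_diagram_lam)
qed

lemma hook_pos: "(a, b) \<in> diagram \<Longrightarrow> hook a b > 0"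
  using le_row_end_iff by (auto simp: diagram_def hook_def)

lemma cyl_hook_lam:
  assumes "(a, b) \<in> diagram"
  shows "real (cyl_hook m l lam (proj m l (a, b))) = hook a b"
proof -
  let ?y = "SOME y. proj m l y = proj m l (a, b)"
  have "proj m l ?y = proj m l (a, b)" by (rule someI) simp
  then obtain k where k: "?y = (a + k * int m, b - k * int l)"
    using proj_eq_iff mem_proj_iff by (metis surj_pair)
  then have "?y \<in> diagram"
    using assms by (simp add: diagram_def row_end_translate)
  then have "periodic_hook m l lam ?y = nat (hook a b)"
    unfolding k by (subst periodic_hook_lam) (simp_all only: hook_translate)
  then show ?thesis using hook_pos[OF assms] by (simp add: cyl_hook_def)
qed

text \<open>A profile \<open>f\<close> encodes the periodic order ideal \<open>{(a, b). b \<le> f a}\<close>, and its rim is the lattice path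
  bounding that ideal. The excited diagrams are the complements of the rims.\<close>

definition profiles :: "(int \<Rightarrow> int) set" where
  "profiles = {f. (\<forall>a. f (a + int m) = f a - int l) \<and> (\<forall>a. f (a + 1) \<le> f a) \<and> (\<forall>a. f a \<le> row_end a)}"

definition rim :: "(int \<Rightarrow> int) \<Rightarrow> (int \<times> int) set" where
  "rim f = {(a, b). f (a + 1) \<le> b \<and> b \<le> f a}"

text \<open>All translates of row a must move together to keep the profile periodic. With d = -1
  this is an excitation, with d = 1 its inverse.\<close>

definition bump :: "int \<Rightarrow> int \<Rightarrow> (int \<Rightarrow> int) \<Rightarrow> int \<Rightarrow> int" where
  "bump d a f = (\<lambda>k. if int m dvd k - a then f k + d else f k)"

section \<open>Profiles, their rims and corner flips\<close>

lemma profileD: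
  assumes "f \<in> profiles"
  shows "f (a + 1) \<le> f a" "f a \<le> row_end a"
  using assms by (auto simp: profiles_def)

lemma profile_translate:
  assumes "f \<in> profiles"
  shows "f (a + k * int m) = f a - k * int l"
proof (induction k rule: int_induct[of _ 0])
  case (step1 i)
  have "f (a + (i + 1) * int m) = f ((a + i * int m) + int m)" by (simp add: algebra_simps)
  also have "\<dots> = f (a + i * int m) - int l" using assms by (simp add: profiles_def)
  finally show ?case using step1 by (simp add: algebra_simps)
next
  case (step2 i)
  have "f (a + i * int m) = f ((a + (i - 1) * int m) + int m)" by (simp add: algebra_simps)
  also have "\<dots> = f (a + (i - 1) * int m) - int l" using assms by (simp add: profiles_def)
  finally show ?case using step2 by (simp add: algebra_simps)
qed simp

lemma profile_antimono: 
  assumes "f \<in> profiles" "a \<le> a'"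
  shows "f a' \<le> f a"
  using assms(2)
proof (induction rule: int_ge_induct)
  case (step i)
  then show ?case using profileD(1)[OF assms(1), of i] by linarith
qed simp

lemma row_end_profile: "row_end \<in> profiles"
proof -
  have "row_end (a + 1) \<le> row_end a" for a
    using m_pos l_pos by (auto simp: row_end_def intro!: mult_left_mono zdiv_mono1)
  then show ?thesis
    using row_end_translate[of _ 1] by (simp add: profiles_def)
qed

lemma profile_eqI:
  assumes "f \<in> profiles" "g \<in> profiles" and eq: "\<And>a. 1 \<le> a \<Longrightarrow> a \<le> int m \<Longrightarrow> f a = g a"
  shows "f = g"
proof
  fix a
  define a' where "a' = (a - 1) mod int m + 1"
  have a: "a = a' + ((a - 1) div int m) * int m"
    using div_mult_mod_eq[of "a - 1" "int m"] unfolding a'_def by linarith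
  have "1 \<le> a'" "a' \<le> int m"
    using m_pos by (auto simp: a'_def zless_imp_add1_zle[OF pos_mod_bound])
  then have "f a' = g a'" by (rule eq)
  then show "f a = g a"
    by (subst (1 2) a) (simp only: profile_translate[OF assms(1)] profile_translate[OF assms(2)])
qed

lemma rim_subset_diagram: "f \<in> profiles \<Longrightarrow> rim f \<subseteq> diagram"
  by (auto simp: rim_def diagram_def intro: order_trans[OF _ profileD(2)])

lemma mem_proj_profile_iff:
  assumes "f \<in> profiles"
  shows "(k, b) \<in> proj m l (a, f a + d) \<longleftrightarrow> int m dvd k - a \<and> b = f k + d"
proof
  assume "int m dvd k - a \<and> b = f k + d"
  then obtain j where "k - a = int m * j" "b = f k + d" by blast
  then have "k = a + j * int m" "b = f k + d" by (auto simp: algebra_simps)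
  then show "(k, b) \<in> proj m l (a, f a + d)"
    by (auto simp: mem_proj_iff profile_translate[OF assms] intro: exI[of _ j])
qed (auto simp: mem_proj_iff profile_translate[OF assms])

lemma rim_translate:
  assumes "f \<in> profiles" "c \<in> proj m l d"
  shows "c \<in> rim f \<longleftrightarrow> d \<in> rim f"
proof -
  have "f (a + k * int m + 1) = f (a + 1) - k * int l" for a k
    using profile_translate[OF assms(1), of "a + 1" k] by (simp add: algebra_simps)
  then show ?thesis
    using assms(2)
    by (cases c; cases d) (auto simp: mem_proj_iff rim_def profile_translate[OF assms(1)])
qed

lemma bump_profile:
  assumes "f \<in> profiles"
    and "d = -1 \<and> f (a + 1) < f a \<or> d = 1 \<and> f a < f (a - 1) \<and> f a < row_end a"
  shows "bump d a f \<in> profiles"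
proof -
  have tr: "f (a + j * int m) = f a - j * int l" "f (a + j * int m + 1) = f (a + 1) - j * int l"
    "f (a + j * int m - 1) = f (a - 1) - j * int l" for j
    using profile_translate[OF assms(1), of a j] profile_translate[OF assms(1), of "a + 1" j]
      profile_translate[OF assms(1), of "a - 1" j] by (simp_all add: algebra_simps)
  \<comment> \<open>Only inequalities between a moved row and an unmoved neighbour are at stake.
    Strictness next to row a carries over to its translates and absorbs the change by one.\<close>
  have step: "bump d a f (k + 1) \<le> bump d a f k" for k
  proof -
    have 1: "d = -1 \<and> f (k + 1) < f k \<or> d = 1 \<and> f k < f (k - 1)" if "int m dvd k - a"
    proof -
      obtain j where "k - a = int m * j" using \<open>int m dvd k - a\<close> by blast
      then have "k = a + j * int m" by (auto simp: algebra_simps)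
      then show ?thesis using assms(2) tr[of j] by auto
    qed
    have 2: "d = -1 \<and> f (k + 2) < f (k + 1) \<or> d = 1 \<and> f (k + 1) < f k" if dvd: "int m dvd k + 1 - a"
    proof -
      obtain j where "k + 1 - a = int m * j" using dvd by blast
      then have k: "k + 1 = a + j * int m" by (auto simp: algebra_simps)
      then have "f (k + 2) = f (a + j * int m + 1)" "f k = f (a + j * int m - 1)"
        by (auto intro: arg_cong[of _ _ f])
      then show ?thesis using assms(2) tr[of j] k by auto
    qed
    show ?thesis
      using 1 2 profileD(1)[OF assms(1), of k] by (auto simp: bump_def)
  qed
  have le: "bump d a f k \<le> row_end k" for k
  proof (cases "int m dvd k - a \<and> d = 1")
    case True
    then obtain j where "k - a = int m * j" by blast
    then have "k = a + j * int m" by (auto simp: algebra_simps)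
    then show ?thesis
      using True assms(2) by (auto simp: bump_def row_end_translate tr)
  next
    case False
    then show ?thesis using assms(2) profileD(2)[OF assms(1), of k] by (auto simp: bump_def)
  qed
  have "int m dvd k + int m - a \<longleftrightarrow> int m dvd k - a" for k
    by (metis add_diff_eq diff_add_eq dvd_add_triv_right_iff)
  then have "bump d a f (k + int m) = bump d a f k - int l" for k
    using profile_translate[OF assms(1), of k 1] by (simp add: bump_def)
  with step le show ?thesis by (simp add: profiles_def)
qed

lemma bump_bump: "bump d a (bump (- d) a f) = f" "bump (- d) a (bump d a f) = f"
  by (auto simp: bump_def)

lemma bump_self: "bump d a f a = f a + d"
  by (simp add: bump_def)

lemma bump_eq: "bump d a f k = (if k = a then f a + d else f k)"
  if "1 \<le> a" "a \<le> int m" "1 \<le> k" "k \<le> int m"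
proof -
  have "k = a" if "int m dvd k - a"
  proof (rule ccontr)
    assume "k \<noteq> a"
    then have "int m \<le> \<bar>k - a\<bar>" using that dvd_imp_le_int[of "k - a" "int m"] by auto
    then show False using \<open>1 \<le> a\<close> \<open>a \<le> int m\<close> \<open>1 \<le> k\<close> \<open>k \<le> int m\<close> by linarith
  qed
  then show ?thesis by (auto simp: bump_def)
qed

text \<open>A cell is on the rim iff it lies in the ideal but its diagonal successor does not.
  Taking the outer corner (a, f a) out of the ideal therefore puts its diagonal predecessor on the
  rim.\<close>

lemma rim_bump:
  assumes "f \<in> profiles" "f (a + 1) < f a"
  shows "rim (bump (-1) a f) = (rim f - proj m l (a, f a)) \<union> proj m l (a - 1, f a - 1)"
proof -
  have mem: "(k, b) \<in> proj m l (a, f a) \<longleftrightarrow> int m dvd k - a \<and> b = f k" for k b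
    using mem_proj_profile_iff[OF assms(1), of k b a 0] by simp
  have mem': "(k, b) \<in> proj m l (a - 1, f a - 1) \<longleftrightarrow> int m dvd k + 1 - a \<and> b = f (k + 1) - 1" for k b
  proof -
    have "(k, b) \<in> proj m l (a - 1, f a - 1) \<longleftrightarrow> (k + 1, b) \<in> proj m l (a, f a - 1)"
      by (auto simp: mem_proj_iff algebra_simps)
    then show ?thesis using mem_proj_profile_iff[OF assms(1), of "k + 1" b a "-1"] by simp
  qed
  have lt: "f (k + 1) < f k" if dvd: "int m dvd k - a" for k
  proof -
    obtain j where "k - a = int m * j" using dvd by blast
    then have k: "k = a + j * int m" by (auto simp: algebra_simps)
    have "f (a + j * int m + 1) = f (a + 1) - j * int l"
      using profile_translate[OF assms(1), of "a + 1" j] by (simp add: algebra_simps)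
    then show ?thesis using assms(2) by (simp add: k profile_translate[OF assms(1)])
  qed
  have "(k, b) \<in> rim (bump (-1) a f) \<longleftrightarrow>
      (k, b) \<in> (rim f - proj m l (a, f a)) \<union> proj m l (a - 1, f a - 1)" for k b
    unfolding Un_iff Diff_iff mem mem' 
    using lt[of k] profileD(1)[OF assms(1), of k] by (auto simp: rim_def bump_def)
  then show ?thesis by auto
qed

lemma rim_inj:
  assumes "f \<in> profiles" "g \<in> profiles" "rim f = rim g"
  shows "f = g"
proof
  fix a
  have "(a, f a) \<in> rim f" "(a, g a) \<in> rim g"
    using profileD(1)[OF assms(1)] profileD(1)[OF assms(2)] by (auto simp: rim_def)
  then have "(a, f a) \<in> rim g" "(a, g a) \<in> rim f" using assms(3) by simp_all
  then show "f a = g a" by (simp add: rim_def)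
qed

lemma corner_in_rim:
  assumes "f \<in> profiles" "f (a + 1) < f a"
  shows "(a, f a) \<in> rim f" "(a - 1, f a - 1) \<notin> rim f" "(a - 1, f a - 1) \<in> diagram"
proof -
  show "(a, f a) \<in> rim f" "(a - 1, f a - 1) \<notin> rim f" using assms by (auto simp: rim_def)
  have "f a \<le> f (a - 1)" using profileD(1)[OF assms(1), of "a - 1"] by simp
  then show "(a - 1, f a - 1) \<in> diagram"
    using profileD(2)[OF assms(1), of "a - 1"] by (simp add: diagram_def)
qed

section \<open>Excitations as corner flips\<close>

lemma diagram_minus_rim_bump:
  assumes "f \<in> profiles" "f (a + 1) < f a"
  shows "diagram - rim (bump (-1) a f) =
    (diagram - rim f - proj m l (a - 1, f a - 1)) \<union> proj m l (a, f a)"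
proof -
  have "proj m l (a, f a) \<subseteq> rim f" "proj m l (a - 1, f a - 1) \<inter> rim f = {}"
    using rim_translate[OF assms(1)] corner_in_rim[OF assms] by blast+
  then show ?thesis
    unfolding rim_bump[OF assms] using rim_subset_diagram[OF assms(1)] by blast
qed

text \<open>The three neighbours of an active cell must lie on the rim, which makes (x + 1, y + 1)
  an outer corner. Excitations are thus the bumps by -1 at row x + 1.\<close>

lemma active_iff:
  assumes "f \<in> profiles"
  shows "active diagram (diagram - rim f) (x, y) \<longleftrightarrow> y + 1 = f (x + 1) \<and> f (x + 2) < f (x + 1)"
proof -
  have "diagram - (diagram - rim f) = rim f" using rim_subset_diagram[OF assms] by blast
  then have *: "active diagram (diagram - rim f) (x, y) \<longleftrightarrow>
      (x, y) \<in> diagram - rim f \<and> (x + 1, y) \<in> rim f \<and> (x, y + 1) \<in> rim f \<and> (x + 1, y + 1) \<in> rim f"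
    by (simp add: active_def)
  have "(x, y) \<in> diagram" if "y + 1 = f (x + 1)"
  proof -
    have "y \<le> f x" using that profileD(1)[OF assms, of x] by simp
    then show ?thesis using profileD(2)[OF assms, of x] by (simp add: diagram_def)
  qed
  then show ?thesis
    using profileD(1)[OF assms, of x] unfolding * by (auto simp: rim_def add.assoc)
qed

text \<open>The number of cells per period between \<open>row_end\<close> and the profile, which is
  the number of excitations needed to reach it.\<close>

definition area :: "(int \<Rightarrow> int) \<Rightarrow> int" where
  "area f = (\<Sum>a = 1..int m. int l + 1 - f a)"

lemma profile_le: "f a \<le> int l + 1" if "f \<in> profiles" "1 \<le> a" 
  using that profile_antimono[OF that] profileD(2)[OF that(1), of 1] by (simp add: row_end_def)

lemma area_nonneg: "f \<in> profiles \<Longrightarrow> area f \<ge> 0"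
  unfolding area_def by (intro sum_nonneg) (auto simp: profile_le)

lemma profile_ge_area: 
  assumes "f \<in> profiles" "1 \<le> a" "a \<le> int m"
  shows "int l + 1 - area f \<le> f a"
proof -
  have "int l + 1 - f a \<le> area f"
    unfolding area_def using assms by (intro member_le_sum) (auto simp: profile_le)
  then show ?thesis by simp
qed

lemma area_bump:
  assumes "1 \<le> a" "a \<le> int m"
  shows "area (bump d a f) = area f - d"
proof -
  have "area (bump d a f) = (\<Sum>k = 1..int m. (int l + 1 - f k) - (if k = a then d else 0))"
    unfolding area_def using assms by (intro sum.cong) (auto simp: bump_eq)
  also have "\<dots> = area f - d" using assms by (simp add: sum_subtractf area_def)
  finally show ?thesis .
qed

lemma profile_area_0:
  assumes "f \<in> profiles" "area f = 0"
  shows "f = row_end"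
  using assms profile_ge_area[OF assms(1)]
  by (intro profile_eqI[OF assms(1) row_end_profile] antisym profileD(2)) (auto simp: row_end_eq)

text \<open>Without an addable row the value at row 0 is passed on to row m unless the top value l +
  1 is met on the way. Periodicity makes f m smaller than f 0, so f m = l + 1, and by monotonicity
  every row of the period is at the top.\<close>

lemma addable_exists:
  assumes "f \<in> profiles" "area f > 0"
  shows "\<exists>a. 1 \<le> a \<and> a \<le> int m \<and> f a < f (a - 1) \<and> f a < row_end a"
proof (rule ccontr)
  assume no_addable: "\<not> ?thesis"
  have no: "f a = row_end a \<or> f a = f (a - 1)" if "1 \<le> a" "a \<le> int m" for a
    using no_addable that profileD(1)[OF assms(1), of "a - 1"] profileD(2)[OF assms(1), of a] by force
  have *: "a \<le> int m \<longrightarrow> f a = int l + 1 \<or> f a = f 0" if "0 \<le> a" for a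
    using that
  proof (induction rule: int_ge_induct)
    case (step i)
    then show ?case using no[of "i + 1"] by (auto simp: row_end_eq)
  qed simp
  have f0: "f (int m) = f 0 - int l" using profile_translate[OF assms(1), of 0 1] by simp
  then have "f (int m) = int l + 1" using *[of "int m"] l_pos by auto
  then have "int l + 1 \<le> f a" if "a \<le> int m" for a
    using profile_antimono[OF assms(1) that] by simp
  then have "area f \<le> 0" unfolding area_def by (intro sum_nonpos) auto
  then show False using assms(2) by simp
qed

lemma diagram_minus_rim_row_end: "diagram - rim row_end = periodic_diagram m l mu"
  unfolding periodic_diagram_mu using profileD(1)[OF row_end_profile]
  by (auto simp: diagram_def rim_def) (meson less_imp_le order_trans)

lemma periodic_excited_eq: "periodic_excited m l lam mu = (\<lambda>f. diagram - rim f) ` profiles"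
proof (intro equalityI subsetI)
  fix D assume "D \<in> periodic_excited m l lam mu"
  then show "D \<in> (\<lambda>f. diagram - rim f) ` profiles"
  proof (induction rule: periodic_excited.induct)
    case init
    then show ?case using diagram_minus_rim_row_end row_end_profile by blast
  next
    case (step D c)
    then obtain f where f: "f \<in> profiles" "D = diagram - rim f" by blast
    obtain x y where c: "c = (x, y)" by force
    have "active diagram (diagram - rim f) (x, y)" using step f c by (simp add: periodic_diagram_lam)
    then have corner: "y + 1 = f (x + 1)" "f (x + 1 + 1) < f (x + 1)"
      using active_iff[OF f(1)] by (auto simp: add.assoc)
    have "bump (-1) (x + 1) f \<in> profiles" using f corner by (intro bump_profile) auto
    moreover have "diagram - rim (bump (-1) (x + 1) f) = D - proj m l c \<union> proj m l (c + (1, 1))"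
    proof -
      have "(x + 1 - 1, f (x + 1) - 1) = c" "(x + 1, f (x + 1)) = c + (1, 1)"
        using corner(1) c by auto
      then show ?thesis using diagram_minus_rim_bump[OF f(1) corner(2)] f(2) by simp
    qed
    ultimately show ?case by blast
  qed
next
  \<comment> \<open>Induction on the number of excitations: raising an addable row undoes one of
    them.\<close>
  have "diagram - rim f \<in> periodic_excited m l lam mu" if "f \<in> profiles" "area f = int n" for f n
    using that
  proof (induction n arbitrary: f)
    case 0
    then have "f = row_end" by (simp add: profile_area_0)
    then show ?case using periodic_excited.init diagram_minus_rim_row_end by metis
  next
    case (Suc n)
    then obtain a where a: "1 \<le> a" "a \<le> int m" "f a < f (a - 1)" "f a < row_end a"
      using addable_exists[of f] by auto
    define g where "g = bump 1 a f"
    have g: "g \<in> profiles" unfolding g_def using Suc.prems a by (intro bump_profile) auto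
    have fg: "f = bump (-1) a g" using bump_bump(2)[of 1 a f] by (simp add: g_def)
    have "area g = int n" using Suc.prems a by (simp add: g_def area_bump)
    then have IH: "diagram - rim g \<in> periodic_excited m l lam mu" using Suc.IH g by simp
    have corner: "g (a + 1) < g a"
    proof -
      have "f (a + 1) \<le> f a" using Suc.prems profileD(1) by blast
      \<comment> \<open>For m = 1 row a + 1 is a translate of row a and is raised as well, so
        strictness has to come from the drop by l per period.\<close>
      moreover have "m = 1 \<Longrightarrow> f (a + 1) < f a"
        using profile_translate[OF Suc.prems(1), of a 1] l_pos by simp
      moreover have "int m dvd 1 \<longleftrightarrow> m = 1" by auto
      ultimately show ?thesis by (auto simp: g_def bump_def)
    qed
    have "active diagram (diagram - rim g) (a - 1, g a - 1)"
      using corner by (simp add: active_iff[OF g] add.commute)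
    then have "(diagram - rim g) - proj m l (a - 1, g a - 1) \<union> proj m l ((a - 1, g a - 1) + (1, 1))
        \<in> periodic_excited m l lam mu"
      by (rule periodic_excited.step[OF IH, unfolded periodic_diagram_lam])
    then show ?case
      using diagram_minus_rim_bump[OF g corner] fg by simp
  qed
  then have "diagram - rim f \<in> periodic_excited m l lam mu" if "f \<in> profiles" for f
    using that area_nonneg[OF that] zero_le_imp_eq_int by blast
  then show "D \<in> periodic_excited m l lam mu" if "D \<in> (\<lambda>f. diagram - rim f) ` profiles" for D
    using that by (auto simp only: image_iff)
qed

end

section \<open>Cancellation of corners\<close>

lemma sum_int_atLeastAtMost_1: "(\<Sum>a = 1..int n. g a) = (\<Sum>i<n. g (int i + 1))"
  by (rule sum.reindex_bij_witness[of _ "\<lambda>i. int i + 1" "\<lambda>a. nat (a - 1)"]) auto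

context cylinder begin

section \<open>Weights of rims and the corner identity\<close>

lemma inj_on_proj_strip: "inj_on (proj m l) {(a, b). 1 \<le> a \<and> a \<le> int m}"
proof (rule inj_onI, clarify)
  fix a b a' b' assume *: "1 \<le> a" "a \<le> int m" "1 \<le> a'" "a' \<le> int m"
    "proj m l (a, b) = proj m l (a', b')"
  then obtain k where k: "a' = a + k * int m" "b' = b - k * int l"
    by (auto simp: proj_eq_iff mem_proj_iff)
  have "k = 0"
  proof (rule ccontr)
    assume "k \<noteq> 0"
    then have "k \<ge> 1 \<or> k \<le> -1" by auto
    then have "k * int m \<ge> int m \<or> k * int m \<le> - int m"
      using m_pos mult_right_mono[of 1 k "int m"] mult_right_mono[of k "-1" "int m"] by auto
    then show False using * k by linarith
  qed
  then show "a = a' \<and> b = b'" using k by simp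
qed

lemma proj_image_rim:
  assumes "f \<in> profiles"
  shows "proj m l ` rim f = proj m l ` (SIGMA a:{1..int m}. {f (a + 1)..f a})"
proof
  show "proj m l ` rim f \<subseteq> proj m l ` (SIGMA a:{1..int m}. {f (a + 1)..f a})"
  proof clarify
    fix a b assume ab: "(a, b) \<in> rim f"
    define k where "k = (a - 1) div int m"
    have a: "a = ((a - 1) mod int m + 1) + k * int m"
      using div_mult_mod_eq[of "a - 1" "int m"] unfolding k_def by linarith
    define a' where "a' = (a - 1) mod int m + 1"
    have "(a, b) \<in> proj m l (a', b + k * int l)"
      using a by (auto simp: mem_proj_iff a'_def intro!: exI[of _ k])
    then have "(a', b + k * int l) \<in> rim f" "proj m l (a, b) = proj m l (a', b + k * int l)"
      using ab rim_translate[OF assms] proj_eq_iff by blast+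
    moreover have "1 \<le> a'" "a' \<le> int m"
      using m_pos by (auto simp: a'_def zless_imp_add1_zle[OF pos_mod_bound])
    ultimately show "proj m l (a, b) \<in> proj m l ` (SIGMA a:{1..int m}. {f (a + 1)..f a})"
      by (auto simp: rim_def)
  qed
qed (auto simp: rim_def)

lemma finite_proj_rim: "f \<in> profiles \<Longrightarrow> finite (proj m l ` rim f)"
  by (simp add: proj_image_rim)

definition weight :: "(int \<Rightarrow> int) \<Rightarrow> real" where
  "weight f = (\<Prod>x\<in>proj m l ` rim f. 1 / real (cyl_hook m l lam x))"

lemma weight_eq_rows:
  assumes "f \<in> profiles"
  shows "weight f = (\<Prod>a = 1..int m. \<Prod>b = f (a + 1)..f a. 1 / hook a b)"
proof -
  let ?S = "SIGMA a:{1..int m}. {f (a + 1)..f a}"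
  have inj: "inj_on (proj m l) ?S"
    by (rule inj_on_subset[OF inj_on_proj_strip]) auto
  have "?S \<subseteq> diagram"
    using rim_subset_diagram[OF assms] by (auto simp: rim_def)
  then have "weight f = (\<Prod>(a, b)\<in>?S. 1 / hook a b)"
    unfolding weight_def proj_image_rim[OF assms] prod.reindex[OF inj]
    by (intro prod.cong) (auto simp: cyl_hook_lam)
  then show ?thesis by (simp add: prod.Sigma)
qed

lemma weight_nonneg: "weight f \<ge> 0"
  unfolding weight_def by (intro prod_nonneg) auto

lemma proj_rim_notin:
  assumes "f \<in> profiles" "c \<in> rim f"
  shows "proj m l c \<notin> proj m l ` (diagram - rim f)"
proof
  assume "proj m l c \<in> proj m l ` (diagram - rim f)"
  then obtain d where d: "d \<notin> rim f" "proj m l c = proj m l d" by blast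
  have "d \<in> proj m l c" using d(2) unfolding proj_eq_iff .
  then show False using d(1) assms rim_translate by blast
qed

lemma proj_diagram_minus:
  assumes "f \<in> profiles"
  shows "proj m l ` diagram - proj m l ` (diagram - rim f) = proj m l ` rim f"
  using proj_rim_notin[OF assms] rim_subset_diagram[OF assms] by blast

lemma excited_weight_eq:
  assumes "f \<in> profiles"
  shows "excited_weight m l lam (proj m l ` (diagram - rim f)) = weight f"
  using proj_diagram_minus[OF assms]
  by (simp add: excited_weight_def weight_def cyl_diagram_def periodic_diagram_lam)

text \<open>A rim is a union of cosets, so it can be read off from the projected complement. The sum
  over excited diagrams may thus be taken over profiles.\<close>

lemma inj_on_complement_rim: "inj_on (\<lambda>f. proj m l ` (diagram - rim f)) profiles"
proof (rule inj_onI)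
  fix f g assume f: "f \<in> profiles" and g: "g \<in> profiles"
    and eq: "proj m l ` (diagram - rim f) = proj m l ` (diagram - rim g)"
  have recover: "rim h = {c \<in> diagram. proj m l c \<notin> proj m l ` (diagram - rim h)}"
    if "h \<in> profiles" for h
    using proj_rim_notin[OF that] rim_subset_diagram[OF that] by blast
  have "rim f = rim g" using recover[OF f] recover[OF g] eq by simp
  then show "f = g" by (rule rim_inj[OF f g])
qed

lemma cyl_excited_eq: "cyl_excited m l lam mu = (\<lambda>f. proj m l ` (diagram - rim f)) ` profiles"
  unfolding cyl_excited_def periodic_excited_eq image_image ..

text \<open>Both sides are the product over the cells common to the two rims: each hook factor
  deletes the one cell in which they differ.\<close>

lemma weight_bump:
  assumes f: "f \<in> profiles" and corner: "f (a + 1) < f a"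
  shows "hook a (f a) * weight f = hook (a - 1) (f a - 1) * weight (bump (-1) a f)"
proof -
  let ?s = "proj m l (a, f a)" and ?s' = "proj m l (a - 1, f a - 1)"
  define R where "R = proj m l ` rim f - {?s}"
  define W where "W = (\<Prod>x\<in>R. 1 / real (cyl_hook m l lam x))"
  note c = corner_in_rim[OF f corner]
  have sub: "(a, f a) \<in> diagram" using c(1) rim_subset_diagram[OF f] by blast
  have fin: "finite R" using finite_proj_rim[OF f] by (simp add: R_def)
  have s'_notin: "?s' \<notin> proj m l ` rim f"
    using c(2) rim_translate[OF f] proj_eq_iff by (metis imageE)
  have R1: "proj m l ` rim f = insert ?s R" "?s \<notin> R" using c(1) by (auto simp: R_def)
  have "weight f = 1 / real (cyl_hook m l lam ?s) * W"
    unfolding weight_def W_def R1(1) using R1(2) fin by simp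
  then have W1: "hook a (f a) * weight f = W"
    using hook_pos[OF sub] by (simp add: cyl_hook_lam[OF sub])
  have class_eq: "proj m l d = proj m l c \<longleftrightarrow> d \<in> proj m l c" for c d
    using proj_eq_iff[of m l c d] by auto
  have "proj m l ` (rim f - ?s) = R"
    using class_eq unfolding R_def by blast
  moreover have "proj m l ` ?s' = {?s'}"
    using class_eq proj_self by blast
  ultimately have R2: "proj m l ` rim (bump (-1) a f) = insert ?s' R"
    unfolding rim_bump[OF f corner] image_Un by auto
  have "?s' \<notin> R" using s'_notin by (simp add: R_def)
  then have "weight (bump (-1) a f) = 1 / real (cyl_hook m l lam ?s') * W"
    unfolding weight_def W_def R2 using fin by simp
  then have "hook (a - 1) (f a - 1) * weight (bump (-1) a f) = W"
    using hook_pos[OF c(3)] by (simp add: cyl_hook_lam[OF c(3)])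
  with W1 show ?thesis by simp
qed

text \<open>The inner corner (a, f (a + 1)) is compared with the outer corner (a, f a) of the same
  row. The row parts of their hooks cancel and a difference of \<open>col_end b - b\<close> remains,
  which is also right when both corners are absent since then f (a + 1) = f a. The differences
  telescope over one turn.\<close>

lemma corner_hook_sum:
  assumes f: "f \<in> profiles"
  shows "(\<Sum>a = 1..int m. if f a < f (a - 1) then hook (a - 1) (f a) else 0)
    - (\<Sum>a = 1..int m. if f (a + 1) < f a then hook a (f a) else 0) = int m + int l"
proof -
  \<comment> \<open>The inner corners reindexed by their own row. This shifts the range to 0..m - 1,
    and periodicity shifts it back.\<close>
  define u where "u a = (if f (a + 1) < f a then hook a (f (a + 1)) else 0)" for a
  define v where "v a = col_end (f a) - f a" for a
  have tr: "f (a + int m) = f a - int l" for a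
    using profile_translate[OF f, of a 1] by simp
  have "u (int m) = u 0"
    using tr[of 0] tr[of 1] hook_translate[of 0 1 "f 1"] by (simp add: u_def add.commute)
  then have "(\<Sum>i<m. u (int i + 1) - u (int i)) = 0"
    using sum_lessThan_telescope[of "\<lambda>i. u (int i)" m] by (simp add: add.commute)
  then have shift: "(\<Sum>i<m. u (int i)) = (\<Sum>i<m. u (int i + 1))"
    by (simp add: sum_subtractf)
  have diff: "u a - (if f (a + 1) < f a then hook a (f a) else 0) = v (a + 1) - v a" for a
    using profileD(1)[OF f, of a] by (auto simp: u_def v_def hook_def)
  have "(\<Sum>a = 1..int m. if f a < f (a - 1) then hook (a - 1) (f a) else 0) = (\<Sum>i<m. u (int i))"
    by (simp add: sum_int_atLeastAtMost_1 u_def cong: if_cong)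
  also have "\<dots> = (\<Sum>i<m. u (int i + 1))" by (rule shift)
  finally have "(\<Sum>a = 1..int m. if f a < f (a - 1) then hook (a - 1) (f a) else 0)
    - (\<Sum>a = 1..int m. if f (a + 1) < f a then hook a (f a) else 0) =
    (\<Sum>i<m. u (int i + 1) - (if f (int i + 1 + 1) < f (int i + 1) then hook (int i + 1) (f (int i + 1)) else 0))"
    by (simp add: sum_int_atLeastAtMost_1 sum_subtractf)
  also have "\<dots> = (\<Sum>i<m. v (int i + 1 + 1) - v (int i + 1))"
    by (simp only: diff)
  also have "\<dots> = v (1 + int m) - v 1"
    using sum_lessThan_telescope[of "\<lambda>i. v (int i + 1)" m] by (simp add: add.commute)
  also have "\<dots> = int m + int l"
    using col_end_translate[of "f 1" 1] tr[of 1] by (simp add: v_def)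
  finally show ?thesis .
qed

section \<open>Telescoping over the number of excitations\<close>

definition level :: "nat \<Rightarrow> (int \<Rightarrow> int) set" where
  "level n = {f \<in> profiles. area f = int n}"

lemma finite_level: "finite (level n)"
proof (rule finite_imageD)
  show "inj_on (\<lambda>f. restrict f {1..int m}) (level n)"
  proof (rule inj_onI)
    fix f g assume "f \<in> level n" "g \<in> level n" and eq: "restrict f {1..int m} = restrict g {1..int m}"
    moreover have "f a = g a" if "1 \<le> a" "a \<le> int m" for a
      using fun_cong[OF eq, of a] that by simp
    ultimately show "f = g" by (intro profile_eqI) (auto simp: level_def)
  qed
  have "(\<lambda>f. restrict f {1..int m}) ` level n \<subseteq> {1..int m} \<rightarrow>\<^sub>E {int l + 1 - int n..int l + 1}"
    using profile_le profile_ge_area by (fastforce simp: level_def)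
  then show "finite ((\<lambda>f. restrict f {1..int m}) ` level n)"
    by (rule finite_subset) (intro finite_PiE; simp)
qed

lemma profiles_eq_levels: "profiles = (\<Union>n. level n)"
proof -
  have "f \<in> level (nat (area f))" if "f \<in> profiles" for f
    using that area_nonneg[OF that] by (simp add: level_def)
  then have "profiles \<subseteq> (\<Union>n. level n)" by blast
  moreover have "(\<Union>n. level n) \<subseteq> profiles" by (auto simp: level_def)
  ultimately show ?thesis by (rule antisym)
qed

text \<open>A corner is indexed by the row that its flip changes: raising row a deletes (a - 1, f a)
  from the rim, lowering it deletes (a, f a). Hence the shift in \<open>up_sum\<close>.\<close>

definition addable :: "(int \<Rightarrow> int) \<Rightarrow> int set" where
  "addable f = {a \<in> {1..int m}. f a < f (a - 1) \<and> f a < row_end a}"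

definition removable :: "(int \<Rightarrow> int) \<Rightarrow> int set" where
  "removable f = {a \<in> {1..int m}. f (a + 1) < f a}"

definition up_sum :: "(int \<Rightarrow> int) \<Rightarrow> int" where
  "up_sum f = (\<Sum>a \<in> addable f. hook (a - 1) (f a))"

definition down_sum :: "(int \<Rightarrow> int) \<Rightarrow> int" where
  "down_sum f = (\<Sum>a \<in> removable f. hook a (f a))"

text \<open>The profiles whose inner corner (0, l + 1) is present but blocked: row 1 is at the top
  and f 0 = f m + l > l + 1. Over one period all cells of the rim except (m, 1) then lie in columns
  2, ..., l + 1.\<close>

definition rect_profiles :: "(int \<Rightarrow> int) set" where
  "rect_profiles = {f \<in> profiles. f 1 = int l + 1 \<and> f (int m) \<ge> 2}"

lemma up_sum_minus_down_sum:
  assumes f: "f \<in> profiles"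
  shows "up_sum f + (if f \<in> rect_profiles then hook (int m) 1 else 0) - down_sum f = int m + int l"
proof -
  let ?U = "{a \<in> {1..int m}. f a < f (a - 1)}"
  have f0: "f 0 = f (int m) + int l" using profile_translate[OF f, of 0 1] by simp
  \<comment> \<open>The blocked inner corners. In rows 2, ..., m such a corner would force f (a - 1)
    > l + 1, so only row 1 remains.\<close>
  define T where "T = {a \<in> ?U. \<not> f a < row_end a}"
  have "a = 1" if "a \<in> T" for a
  proof (rule ccontr)
    assume "a \<noteq> 1"
    then have "1 \<le> a - 1" "1 \<le> a" "a \<le> int m" "f a < f (a - 1)" "\<not> f a < row_end a"
      using that by (auto simp: T_def)
    then show False using profile_le[OF f, of "a - 1"] by (simp add: row_end_eq)
  qed
  moreover have "1 \<in> T \<longleftrightarrow> f \<in> rect_profiles"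
    using f f0 m_pos profile_le[OF f, of 1] by (auto simp: T_def rect_profiles_def row_end_eq)
  ultimately have "T = (if f \<in> rect_profiles then {1} else {})"
    by (cases "f \<in> rect_profiles") (simp_all, blast+)
  moreover have "hook 0 (f 1) = hook (int m) 1" if "f \<in> rect_profiles"
    using that hook_translate[of 0 1 "int l + 1"] by (simp add: rect_profiles_def)
  ultimately have "(\<Sum>a \<in> T. hook (a - 1) (f a)) =
      (if f \<in> rect_profiles then hook (int m) 1 else 0)" by simp
  moreover have "(\<Sum>a \<in> ?U. hook (a - 1) (f a)) =
      up_sum f + (\<Sum>a \<in> T. hook (a - 1) (f a))"
    unfolding up_sum_def
    by (subst sum.union_disjoint[symmetric])
      (auto intro!: sum.cong intro: finite_subset[of _ "{1..int m}"] simp: addable_def T_def)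
  moreover have "(\<Sum>a \<in> ?U. hook (a - 1) (f a)) =
      (\<Sum>a = 1..int m. if f a < f (a - 1) then hook (a - 1) (f a) else 0)"
    by (rule sum.inter_filter) simp
  moreover have "down_sum f = (\<Sum>a = 1..int m. if f (a + 1) < f a then hook a (f a) else 0)"
    unfolding down_sum_def removable_def by (rule sum.inter_filter) simp
  ultimately show ?thesis using corner_hook_sum[OF f] by simp
qed

lemma bump_addable:
  assumes "f \<in> level (Suc n)" "a \<in> addable f"
  shows "bump 1 a f \<in> level n" "a \<in> removable (bump 1 a f)"
proof -
  have f: "f \<in> profiles" and a: "1 \<le> a" "a \<le> int m" "f a < f (a - 1)" "f a < row_end a"
    using assms by (auto simp: level_def addable_def)
  then have "bump 1 a f \<in> profiles" by (intro bump_profile) auto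
  then show "bump 1 a f \<in> level n" using assms(1) a by (simp add: level_def area_bump)
  have "f (a + 1) \<le> f a" using f profileD(1) by blast
  moreover have "m = 1 \<Longrightarrow> f (a + 1) < f a"
    using profile_translate[OF f, of a 1] l_pos by simp
  moreover have "int m dvd 1 \<longleftrightarrow> m = 1" by auto
  ultimately show "a \<in> removable (bump 1 a f)"
    using a by (auto simp: removable_def bump_def)
qed

lemma bump_removable:
  assumes "f \<in> level n" "a \<in> removable f"
  shows "bump (-1) a f \<in> level (Suc n)" "a \<in> addable (bump (-1) a f)"
proof -
  have f: "f \<in> profiles" and a: "1 \<le> a" "a \<le> int m" "f (a + 1) < f a"
    using assms by (auto simp: level_def removable_def)
  then have "bump (-1) a f \<in> profiles" by (intro bump_profile) auto
  then show "bump (-1) a f \<in> level (Suc n)" using assms(1) a by (simp add: level_def area_bump)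
  have "f a \<le> f (a - 1)" using profileD(1)[OF f, of "a - 1"] by simp
  moreover have "m = 1 \<Longrightarrow> f a < f (a - 1)"
    using profile_translate[OF f, of "a - 1" 1] l_pos by simp
  moreover have "int m dvd - 1 \<longleftrightarrow> m = 1" by auto
  moreover have "f a \<le> row_end a" using profileD(2)[OF f] .
  ultimately show "a \<in> addable (bump (-1) a f)"
    using a by (auto simp: addable_def bump_def)
qed

text \<open>Pushing a corner inwards exchanges one cell of the rim for another, and \<open>weight_bump\<close>
  says that both sides range over the same terms.\<close>

lemma sum_up_eq_sum_down:
  "(\<Sum>f\<in>level (Suc n). weight f * up_sum f) = (\<Sum>f\<in>level n. weight f * down_sum f)"
proof -
  have fin: "finite (addable f)" "finite (removable f)" for f
    by (rule finite_subset[of _ "{1..int m}"]; auto simp: addable_def removable_def)+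
  have "(\<Sum>f\<in>level (Suc n). weight f * up_sum f) =
      (\<Sum>(f, a)\<in>Sigma (level (Suc n)) addable. weight f * hook (a - 1) (f a))"
    by (simp add: up_sum_def sum_distrib_left sum.Sigma finite_level fin)
  also have "\<dots> = (\<Sum>(f, a)\<in>Sigma (level n) removable. weight f * hook a (f a))"
  proof (rule sum.reindex_bij_witness[of _ "\<lambda>(f, a). (bump (-1) a f, a)" "\<lambda>(f, a). (bump 1 a f, a)"];
      clarsimp simp: bump_addable bump_removable bump_bump bump_bump[of 1, simplified])
    fix f a assume fa: "f \<in> level (Suc n)" "a \<in> addable f"
    have "bump 1 a f \<in> profiles" "bump 1 a f (a + 1) < bump 1 a f a"
      using bump_addable[OF fa] by (auto simp: level_def removable_def)
    from weight_bump[OF this]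
    show "weight (bump 1 a f) * hook a (bump 1 a f a) = weight f * hook (a - 1) (f a)"
      using bump_bump[of "-1" a f] by (simp add: bump_self mult.commute)
  qed
  also have "\<dots> = (\<Sum>f\<in>level n. weight f * down_sum f)"
    by (simp add: down_sum_def sum_distrib_left sum.Sigma finite_level fin)
  finally show ?thesis .
qed

lemma rect_profiles_area:
  assumes "f \<in> rect_profiles"
  shows "area f \<le> int (m * l)"
proof -
  have "f \<in> profiles" "f (int m) \<ge> 2" using assms by (auto simp: rect_profiles_def)
  then have "2 \<le> f a" if "a \<le> int m" for a
    using profile_antimono[of f a "int m"] that by simp
  then have "area f \<le> (\<Sum>a = 1..int m. int l)"
    unfolding area_def by (intro sum_mono) force
  then show ?thesis by simp
qed

lemma disjoint_levels: "disjoint_family level"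
  unfolding disjoint_family_on_def by (auto simp: level_def)

text \<open>The flippable inner corners of level k + 1 cancel the outer corners of level k. The
  outer corners of level n have no partner yet and form the error term.\<close>

lemma telescope_levels:
  assumes "n \<ge> m * l"
  shows "(real m + real l) * (\<Sum>k\<le>n. sum weight (level k)) + (\<Sum>f\<in>level n. weight f * down_sum f)
    = (\<Sum>f\<in>rect_profiles. weight f * hook (int m) 1)"
proof -
  define h where "h f = (if f \<in> rect_profiles then hook (int m) 1 else 0)" for f
  define base where "base f = weight f * h f" for f
  have one: "(real m + real l) * weight f = weight f * up_sum f + base f - weight f * down_sum f"
    if "f \<in> profiles" for f
  proof -
    have "real m + real l = of_int (int m + int l)" by simp
    also have "\<dots> = real_of_int (up_sum f) + h f - down_sum f"
      using up_sum_minus_down_sum[OF that] by (simp only: h_def flip: of_int_add of_int_diff)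
    finally have "real m + real l = real_of_int (up_sum f) + h f - down_sum f" .
    then show ?thesis by (simp only: base_def) (simp only: algebra_simps)
  qed
  have lev: "(real m + real l) * sum weight (level k) =
      (\<Sum>f\<in>level k. weight f * up_sum f) + sum base (level k) - (\<Sum>f\<in>level k. weight f * down_sum f)" for k
  proof -
    have "(real m + real l) * sum weight (level k) =
        (\<Sum>f\<in>level k. weight f * up_sum f + base f - weight f * down_sum f)"
      unfolding sum_distrib_left by (intro sum.cong refl one) (simp add: level_def)
    then show ?thesis by (simp add: sum.distrib sum_subtractf)
  qed
  have "(real m + real l) * (\<Sum>k\<le>N. sum weight (level k)) + (\<Sum>f\<in>level N. weight f * down_sum f)
    = (\<Sum>k\<le>N. sum base (level k))" for N
  proof (induction N)
    \<comment> \<open>Level 0 contains only \<open>row_end\<close>, where no row can be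
      raised.\<close>
    case 0
    have "up_sum f = 0" if "f \<in> level 0" for f
    proof -
      have "f = row_end" using that by (simp add: level_def profile_area_0)
      then show ?thesis by (simp add: up_sum_def addable_def)
    qed
    then show ?case by (simp add: lev)
  next
    case (Suc N)
    then show ?case by (simp add: distrib_left lev sum_up_eq_sum_down)
  qed
  also have "(\<Sum>k\<le>n. sum base (level k)) = sum base (\<Union>k\<le>n. level k)"
    using disjoint_levels by (subst sum.UNION_disjoint) (auto simp: finite_level disjoint_family_on_def)
  \<comment> \<open>From n = m * l on, the levels cover all blocked profiles, so the right-hand side
    no longer depends on n.\<close>
  also have "\<dots> = sum base rect_profiles"
  proof (rule sum.mono_neutral_right)
    show "finite (\<Union>k\<le>n. level k)" by (simp add: finite_level)
    show "rect_profiles \<subseteq> (\<Union>k\<le>n. level k)"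
    proof
      fix f assume f: "f \<in> rect_profiles"
      then have "f \<in> profiles" by (simp add: rect_profiles_def)
      then show "f \<in> (\<Union>k\<le>n. level k)"
        using area_nonneg[of f] order_trans[OF rect_profiles_area[OF f], of "int n"] assms
        by (auto simp: level_def nat_le_iff simp flip: of_nat_mult intro!: bexI[of _ "nat (area f)"])
    qed
  qed (auto simp: base_def h_def)
  also have "\<dots> = (\<Sum>f\<in>rect_profiles. weight f * hook (int m) 1)"
    by (simp add: base_def h_def)
  finally show ?thesis .
qed

text \<open>Linear growth in n is what the harmonic comparison requires. In level n an outer corner
  has arm at most n and leg at most m + m * n - 1, and there are at most m of them per
  period.\<close>

lemma down_sum_bounds:
  assumes "f \<in> level n"
  shows "0 \<le> down_sum f" "down_sum f \<le> int (m * (m + 1) * (n + 1))"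
proof -
  have f: "f \<in> profiles" "area f = int n" using assms by (auto simp: level_def)
  have hook: "0 \<le> hook a (f a) \<and> hook a (f a) \<le> int ((m + 1) * (n + 1))" if a: "1 \<le> a" "a \<le> int m" for a
  proof
    have "(a, f a) \<in> diagram" using profileD(2)[OF f(1)] by (simp add: diagram_def)
    then show "0 \<le> hook a (f a)" using hook_pos by fastforce
    have fa: "int l + 1 - int n \<le> f a" using profile_ge_area[OF f(1) a] f(2) by simp
    then have "(int l + 1 - f a) div int l \<le> int n div int l"
      using l_pos by (intro zdiv_mono1) auto
    also have "\<dots> \<le> int n" using zdiv_mono2[of "int n" 1 "int l"] l_pos by simp
    finally have "col_end (f a) \<le> int m + int m * int n"
      using m_pos by (simp add: col_end_def)
    then show "hook a (f a) \<le> int ((m + 1) * (n + 1))"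
      using fa a by (simp add: hook_def row_end_eq algebra_simps)
  qed
  show "0 \<le> down_sum f"
    unfolding down_sum_def by (intro sum_nonneg) (simp add: removable_def hook)
  have "down_sum f \<le> of_nat (card (removable f)) * int ((m + 1) * (n + 1))"
    unfolding down_sum_def by (intro sum_bounded_above) (simp only: removable_def hook mem_Collect_eq atLeastAtMost_iff)
  also have "\<dots> \<le> int m * int ((m + 1) * (n + 1))"
  proof (intro mult_right_mono)
    have "card (removable f) \<le> card {1..int m}" by (intro card_mono) (auto simp: removable_def)
    then show "int (card (removable f)) \<le> int m" by simp
  qed simp
  finally show "down_sum f \<le> int (m * (m + 1) * (n + 1))" by (simp add: algebra_simps)
qed

end

section \<open>Blocked profiles as paths in the rectangle\<close>

lemma prod_int_atLeastAtMost_1: "(\<Prod>a = 1..int n. g a) = (\<Prod>i<n. g (int i + 1))"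
  by (rule prod.reindex_bij_witness[of _ "\<lambda>i. int i + 1" "\<lambda>a. nat (a - 1)"]) auto

context cylinder begin

definition profile_of :: "(nat \<Rightarrow> nat) \<Rightarrow> int \<Rightarrow> int" where
  "profile_of g a = int l + 1 - int (g (nat ((a - 1) mod int m))) - int l * ((a - 1) div int m)"

text \<open>The tail value l - 1 stands for column 2, where the path leaves the rectangle; the cell
  (m, 1) after it is not part of the path.\<close>

definition staircase_of :: "(int \<Rightarrow> int) \<Rightarrow> nat \<Rightarrow> nat" where
  "staircase_of f i = (if i < m then nat (int l + 1 - f (int i + 1)) else l - 1)"

lemma profile_of_eq: "profile_of g a = int l + 1 - int (g (nat (a - 1)))"
  if "1 \<le> a" "a \<le> int m"
  using that by (simp add: profile_of_def)

lemma profile_of_in: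
  assumes "g \<in> staircases m (l - 1)"
  shows "profile_of g \<in> rect_profiles"
proof -
  have g: "mono g" "g 0 = 0" "g m = l - 1" using assms by (auto simp: staircases_def)
  have le: "profile_of g (a + 1) \<le> profile_of g a" for a
  proof -
    define q r where "q = (a - 1) div int m" and "r = nat ((a - 1) mod int m)"
    have r: "r < m" and a: "a = q * int m + int r + 1"
      using m_pos div_mult_mod_eq[of "a - 1" "int m"] by (auto simp: q_def r_def nat_less_iff)
    show ?thesis
    proof (cases "Suc r < m")
      case True
      have "a div int m = q" "a mod int m = int (Suc r)"
        using True a by (auto intro!: int_div_pos_eq int_mod_pos_eq)
      moreover have "g r \<le> g (Suc r)" using g by (simp add: monoD)
      moreover have "nat (1 + int r) = Suc r" by simp
      ultimately show ?thesis by (simp add: profile_of_def q_def[symmetric] r_def[symmetric])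
    next
      \<comment> \<open>The next period restarts at g 0 = 0 but l lower, so monotonicity holds
        because g is at most l - 1.\<close>
      case False
      then have "a = (q + 1) * int m" using a r by (simp add: algebra_simps)
      then have "a div int m = q + 1" "a mod int m = 0" using m_pos by auto
      moreover have "g r \<le> l - 1" using g r monoD[of g r m] by simp
      ultimately show ?thesis
        using g l_pos by (simp add: profile_of_def q_def[symmetric] r_def[symmetric] algebra_simps)
    qed
  qed
  have "(a + int m - 1) div int m = (a - 1) div int m + 1"
    "(a + int m - 1) mod int m = (a - 1) mod int m" for a
    using div_add_self2[of "int m" "a - 1"] mod_add_self2[of "a - 1" "int m"] m_pos
    by (simp_all add: algebra_simps)
  then have "profile_of g (a + int m) = profile_of g a - int l" for a
    by (simp add: profile_of_def algebra_simps)
  moreover have "profile_of g a \<le> row_end a" for a by (simp add: profile_of_def row_end_def)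
  ultimately have "profile_of g \<in> profiles" using le by (simp add: profiles_def)
  moreover have "g (m - 1) \<le> l - 1" using g monoD[of g "m - 1" m] by simp
  then have "2 \<le> profile_of g (int m)"
    using m_pos l_pos by (simp add: profile_of_eq nat_diff_distrib)
  ultimately show ?thesis using g m_pos by (simp add: rect_profiles_def profile_of_eq)
qed

lemma staircase_of_in:
  assumes "f \<in> rect_profiles"
  shows "staircase_of f \<in> staircases m (l - 1)"
proof -
  have f: "f \<in> profiles" "f 1 = int l + 1" "2 \<le> f (int m)" using assms by (auto simp: rect_profiles_def)
  have "staircase_of f i \<le> staircase_of f (Suc i)" for i
  proof -
    consider "Suc i < m" | "Suc i = m" | "m \<le> i" by linarith
    then show ?thesis
    proof cases
      case 1
      then show ?thesis
        using profileD(1)[OF f(1), of "int i + 1"] by (simp add: staircase_of_def add.commute)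
    next
      case 2
      then have "f (int i + 1) \<ge> 2" using f(3) by (simp add: add.commute flip: 2)
      then show ?thesis using 2 by (simp add: staircase_of_def)
    qed (simp add: staircase_of_def)
  qed
  then have "mono (staircase_of f)" by (simp add: mono_iff_le_Suc)
  then show ?thesis using f m_pos by (simp add: staircases_def staircase_of_def)
qed

lemma staircase_of_profile_of:
  assumes "g \<in> staircases m (l - 1)"
  shows "staircase_of (profile_of g) = g"
  using assms by (auto simp: staircase_of_def profile_of_eq staircases_def fun_eq_iff)

lemma profile_of_staircase_of:
  assumes "f \<in> rect_profiles"
  shows "profile_of (staircase_of f) = f"
proof (rule profile_eqI)
  show f: "f \<in> profiles" using assms by (simp add: rect_profiles_def)
  show "profile_of (staircase_of f) \<in> profiles"
    using profile_of_in[OF staircase_of_in[OF assms]] by (simp add: rect_profiles_def)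
  fix a assume "1 \<le> a" "a \<le> int m"
  then show "profile_of (staircase_of f) a = f a"
    using profile_le[OF f] by (simp add: profile_of_eq staircase_of_def nat_less_iff)
qed

text \<open>Inside the rectangle both ends are constant. The bound on y keeps away from column 1,
  where \<open>col_end\<close> jumps to 2 * m.\<close>

lemma row_prod_reindex:
  assumes "i < m" "x \<le> y" "y \<le> l - 1"
  shows "(\<Prod>b = int l + 1 - int y..int l + 1 - int x. 1 / real_of_int (hook (int i + 1) b)) =
    (\<Prod>d = x..y. 1 / (real (m - i) + real d))"
proof (rule prod.reindex_bij_witness[of _ "\<lambda>d. int l + 1 - int d" "\<lambda>b. nat (int l + 1 - b)"])
  fix b assume b: "b \<in> {int l + 1 - int y..int l + 1 - int x}"
  then have "2 \<le> b" "b \<le> int l + 1" using assms l_pos by auto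
  then have "hook (int i + 1) b = int l + 1 - b + (int m - int i)"
    using assms(1) by (simp add: hook_def row_end_eq col_end_eq)
  then show "1 / (real (m - i) + real (nat (int l + 1 - b))) = 1 / real_of_int (hook (int i + 1) b)"
    using assms(1) \<open>b \<le> int l + 1\<close> by (simp add: of_nat_diff algebra_simps)
qed auto

text \<open>Over one period the rim is the rectangle path together with (m, 1); the factor
  \<open>hook (int m) 1\<close> deletes that cell.\<close>

lemma rect_profile_weight:
  assumes "f \<in> rect_profiles"
  shows "weight f * hook (int m) 1 = staircase_weight m m (staircase_of f)"
proof -
  let ?g = "staircase_of f"
  have f: "f \<in> profiles" "f 1 = int l + 1" "2 \<le> f (int m)" using assms by (auto simp: rect_profiles_def)
  have g: "mono ?g" "?g m = l - 1" using staircase_of_in[OF assms] by (auto simp: staircases_def)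
  obtain k where k: "m = Suc k" using m_pos by (cases m) auto
  have fg: "f (int i + 1) = int l + 1 - int (?g i)" if "i < m" for i
    using that profile_le[OF f(1), of "int i + 1"] by (simp add: staircase_of_def)
  define R where "R i = (\<Prod>b = f (int i + 1 + 1)..f (int i + 1). 1 / real_of_int (hook (int i + 1) b))" for i :: nat
  define Q where "Q i = (\<Prod>d = ?g i..?g (Suc i). 1 / (real (m - i) + real d))" for i
  have gle: "?g i \<le> ?g (Suc i)" "i < m \<Longrightarrow> ?g (Suc i) \<le> l - 1" for i
    using monoD[OF g(1), of i "Suc i"] monoD[OF g(1), of "Suc i" m] g(2) by auto
  have RQ: "R i = Q i" if "i < k" for i
  proof -
    have "int i + 1 + 1 = int (Suc i) + 1" by simp
    then have "f (int i + 1 + 1) = int l + 1 - int (?g (Suc i))"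
      using fg[of "Suc i"] that k by simp
    then show ?thesis
      unfolding R_def Q_def using row_prod_reindex[of i "?g i" "?g (Suc i)"] gle[of i] fg[of i] that k by simp
  qed
  \<comment> \<open>Row m + 1 is row 1 moved down by l, so row m of the rim reaches down to column
    1, one cell beyond the rectangle.\<close>
  have f1: "f (int k + 1 + 1) = 1"
    using profile_translate[OF f(1), of 1 1] f(2) k by (simp add: add.commute)
  have "{1..f (int m)} = insert 1 {2..f (int m)}" using f(3) by auto
  then have "R k = 1 / real_of_int (hook (int m) 1) * (\<Prod>b = 2..f (int m). 1 / real_of_int (hook (int m) b))"
    unfolding R_def f1 using k by (simp add: add.commute)
  also have "(\<Prod>b = 2..f (int m). 1 / real_of_int (hook (int m) b)) = Q k"
    using row_prod_reindex[of k "?g k" "?g (Suc k)"] gle[of k] fg[of k] k g(2) l_pos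
    by (simp add: Q_def add.commute)
  finally have Rk: "R k = 1 / real_of_int (hook (int m) 1) * Q k" .
  have "(int m, 1) \<in> diagram" using m_pos by (simp add: diagram_def row_end_eq)
  then have "hook (int m) 1 > 0" by (rule hook_pos)
  then have RkQk: "R k * hook (int m) 1 = Q k" unfolding Rk by simp
  have split_last: "(\<Prod>i<m. h i) = (\<Prod>i<k. h i) * h k" for h :: "nat \<Rightarrow> real"
    using k by simp
  have "weight f = (\<Prod>i<k. R i) * R k"
    unfolding weight_eq_rows[OF f(1)] prod_int_atLeastAtMost_1 R_def split_last ..
  moreover have "staircase_weight m m ?g = (\<Prod>i<k. Q i) * Q k"
    unfolding staircase_weight_def Q_def split_last ..
  ultimately show ?thesis using RQ RkQk by simp
qed

lemma sum_rect_profiles: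
  "(\<Sum>f\<in>rect_profiles. weight f * hook (int m) 1) = real ((l + m - 2) choose (m - 1)) / fact (m + l - 1)"
proof -
  have "(\<Sum>f\<in>rect_profiles. weight f * hook (int m) 1) =
      (\<Sum>g\<in>staircases m (l - 1). staircase_weight m m g)"
    by (rule sum.reindex_bij_witness[of _ profile_of staircase_of])
      (auto simp del: One_nat_def simp: profile_of_in staircase_of_in staircase_of_profile_of profile_of_staircase_of rect_profile_weight)
  also have "\<dots> = real ((m - 1 + (l - 1)) choose (l - 1)) / fact (m + (l - 1))"
    using sum_staircases[of "m - 1" m "l - 1"] m_pos by simp
  also have "(m - 1 + (l - 1)) choose (l - 1) = (l + m - 2) choose (m - 1)"
    using binomial_symmetric[of "l - 1" "m - 1 + (l - 1)"] m_pos l_pos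
    by (simp add: add.commute numeral_2_eq_2)
  also have "m + (l - 1) = m + l - 1" using l_pos by simp
  finally show ?thesis .
qed

end

section \<open>The closed strip\<close>

lemma cyl_le_proj_iff:
  "cyl_le m l (proj m l (a, b)) (proj m l (a', b')) \<longleftrightarrow>
    (\<exists>k. a \<le> a' + k * int m \<and> b \<le> b' - k * int l)"
proof
  assume "cyl_le m l (proj m l (a, b)) (proj m l (a', b'))"
  then obtain c d where cd: "proj m l c = proj m l (a, b)" "proj m l d = proj m l (a', b')" "c \<le> d"
    unfolding cyl_le_def by blast
  obtain i where i: "c = (a + i * int m, b - i * int l)"
    using cd(1) proj_self[of c m l] by (cases c) (auto simp: mem_proj_iff)
  obtain j where j: "d = (a' + j * int m, b' - j * int l)"
    using cd(2) proj_self[of d m l] by (cases d) (auto simp: mem_proj_iff)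
  have "a \<le> a' + (j - i) * int m \<and> b \<le> b' - (j - i) * int l"
    using cd(3) unfolding i j by (simp add: algebra_simps)
  then show "\<exists>k. a \<le> a' + k * int m \<and> b \<le> b' - k * int l" ..
next
  assume "\<exists>k. a \<le> a' + k * int m \<and> b \<le> b' - k * int l"
  then obtain k where "(a, b) \<le> (a' + k * int m, b' - k * int l)" by auto
  then show "cyl_le m l (proj m l (a, b)) (proj m l (a', b'))"
    unfolding cyl_le_def using proj_translate by blast
qed

context cylinder begin

text \<open>The strip runs once around the cylinder, from \<open>(0, l + 1)\<close>, which is the cell \<open>(m, 1)\<close>,
  down the last column and then along the last row to \<open>(m, l + 1)\<close>.\<close>

definition strip_cell :: "nat \<Rightarrow> int \<times> int" where
  "strip_cell i = (if i < m then (int i, int l + 1) else (int m, int i - int m + 2))"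

lemma cyl_skew_eq: "cyl_skew m l lam mu = (\<lambda>i. proj m l (strip_cell i)) ` {..<m + l}"
proof -
  have re: "row_end (int m + 1) = 1" using m_pos by (simp add: row_end_def)
  have c0: "proj m l (strip_cell 0) = proj m l (int m, 1)"
    using proj_translate[of m l 0 1 "int l + 1"] m_pos by (simp add: strip_cell_def)
  have "cyl_skew m l lam mu = proj m l ` rim row_end"
    using proj_diagram_minus[OF row_end_profile]
    by (simp only: cyl_skew_def cyl_diagram_def periodic_diagram_lam diagram_minus_rim_row_end)
  also have "\<dots> = proj m l ` (SIGMA a:{1..int m}. {row_end (a + 1)..row_end a})"
    by (rule proj_image_rim[OF row_end_profile])
  also have "\<dots> = (\<lambda>i. proj m l (strip_cell i)) ` {..<m + l}" (is "?A = ?B")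
  proof
    show "?A \<subseteq> ?B"
    proof clarify
      fix a b assume ab: "a \<in> {1..int m}" "b \<in> {row_end (a + 1)..row_end a}"
      then consider "a < int m" "b = int l + 1" | "a = int m" "b = 1"
        | "a = int m" "2 \<le> b" "b \<le> int l + 1"
        using re by (cases "a = int m"; cases "b = 1") (auto simp: row_end_eq)
      then show "proj m l (a, b) \<in> ?B"
      proof cases
        case 1
        then show ?thesis using ab by (intro image_eqI[of _ _ "nat a"]) (auto simp: strip_cell_def)
      next
        case 2
        then show ?thesis using c0 m_pos by (intro image_eqI[of _ _ 0]) auto
      next
        case 3
        then show ?thesis
          by (intro image_eqI[of _ _ "m + nat (b - 2)"]) (auto simp: strip_cell_def)
      qed
    qed
    show "?B \<subseteq> ?A"
    proof clarify
      fix i assume i: "i < m + l"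
      have "(int m, 1) \<in> (SIGMA a:{1..int m}. {row_end (a + 1)..row_end a})"
        using m_pos re by (simp add: row_end_eq)
      moreover have "strip_cell i \<in> (SIGMA a:{1..int m}. {row_end (a + 1)..row_end a})" if "i \<noteq> 0"
        using that i m_pos re by (auto simp: strip_cell_def row_end_eq)
      ultimately show "proj m l (strip_cell i) \<in> ?A"
        using c0 by (cases "i = 0") (auto intro!: imageI)
    qed
  qed
  finally show ?thesis .
qed

text \<open>A nonzero winding shifts by at least m rows and l columns, as much as the strip is long.
  It creates relations only from the least cell, which occurs both above the column and, as (m, 1),
  at the start of the row.\<close>

lemma strip_cell_le_iff:
  assumes "i < m + l" "j < m + l" "i \<noteq> j"
  shows "cyl_le m l (proj m l (strip_cell i)) (proj m l (strip_cell j)) \<longleftrightarrow>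
    i < j \<and> \<not> (1 \<le> i \<and> i < m \<and> m \<le> j \<and> j < m + l - 1)"
proof -
  obtain a b a' b' where ab: "strip_cell i = (a, b)" "strip_cell j = (a', b')" by force
  \<comment> \<open>Naming the products \<open>u\<close> and \<open>v\<close> and bounding them
    leaves a linear problem in the final case analysis.\<close>
  have winding: "\<exists>u v. k * int m = u \<and> k * int l = v \<and>
      (u = 0 \<and> v = 0 \<or> u \<ge> int m \<and> v \<ge> int l \<or> u \<le> - int m \<and> v \<le> - int l)" for k :: int
  proof -
    consider "k = 0" | "k \<ge> 1" | "k \<le> -1" by linarith
    then show ?thesis
    proof cases
      case 2
      then show ?thesis using mult_right_mono[of 1 k "int m"] mult_right_mono[of 1 k "int l"] by simp
    next
      case 3
      then show ?thesis using mult_right_mono[of k "-1" "int m"] mult_right_mono[of k "-1" "int l"] by simp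
    qed simp
  qed
  have "(\<exists>k. a \<le> a' + k * int m \<and> b \<le> b' - k * int l) \<longleftrightarrow>
      i < j \<and> \<not> (1 \<le> i \<and> i < m \<and> m \<le> j \<and> j < m + l - 1)" (is "?L \<longleftrightarrow> ?R")
  proof
    assume ?L
    then obtain k where k1: "a \<le> a' + k * int m" "b \<le> b' - k * int l" by blast
    from winding[of k] obtain u v where uv: "k * int m = u" "k * int l = v"
      "u = 0 \<and> v = 0 \<or> u \<ge> int m \<and> v \<ge> int l \<or> u \<le> - int m \<and> v \<le> - int l" by blast
    show ?R
      using uv(3) k1[unfolded uv(1,2)] ab assms m_pos l_pos by (auto simp: strip_cell_def split: if_splits)
  next
    assume R: ?R
    show ?L
    proof (cases "i = 0 \<and> m \<le> j")
      \<comment> \<open>Here the least cell is used in its form (m, 1), one turn away from (0, l +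
        1).\<close>
      case True
      then show ?thesis using ab m_pos l_pos by (intro exI[of _ "-1"]) (auto simp: strip_cell_def)
    next
      case False
      then show ?thesis using R ab assms by (intro exI[of _ 0]) (auto simp: strip_cell_def split: if_splits)
    qed
  qed
  then show ?thesis by (simp add: ab cyl_le_proj_iff)
qed

lemma num_linear_extensions_eq: "num_linear_extensions m l lam mu = (l + m - 2) choose (m - 1)"
proof -
  have N: "m - 1 + (l - 1) + 2 = m + l" "m - 1 + (l - 1) = l + m - 2" using m_pos l_pos by auto
  have refl: "cyl_le m l (proj m l c) (proj m l c)" for c
    unfolding cyl_le_def by (rule exI[of _ c])+ simp
  have inj: "inj_on (\<lambda>i. proj m l (strip_cell i)) {..<m + l}"
  proof (rule inj_onI, rule ccontr)
    fix i j assume "i \<in> {..<m + l}" "j \<in> {..<m + l}" "i \<noteq> j"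
      "proj m l (strip_cell i) = proj m l (strip_cell j)"
    \<comment> \<open>Equal classes are comparable both ways by reflexivity, which would give i < j
      and j < i.\<close>
    then show False
      using strip_cell_le_iff[of i j] strip_cell_le_iff[of j i] refl by auto
  qed
  have "card (linear_extensions (cyl_le m l)
      ((\<lambda>i. proj m l (strip_cell i)) ` {..<m - 1 + (l - 1) + 2})) = (m - 1 + (l - 1)) choose (m - 1)"
  proof (rule card_linear_extensions_two_chains)
    show "inj_on (\<lambda>i. proj m l (strip_cell i)) {..<m - 1 + (l - 1) + 2}"
      unfolding N(1) by (rule inj)
    fix i j assume ij: "i < m - 1 + (l - 1) + 2" "j < m - 1 + (l - 1) + 2" "i \<noteq> j"
    show "cyl_le m l (proj m l (strip_cell i)) (proj m l (strip_cell j)) \<longleftrightarrow>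
        i < j \<and> \<not> (1 \<le> i \<and> i \<le> m - 1 \<and> m - 1 < j \<and> j \<le> m - 1 + (l - 1))"
      unfolding strip_cell_le_iff[OF ij[unfolded N(1)]]
      using m_pos l_pos by linarith
  qed
  note this[unfolded N(1), unfolded N(2)]
  then show ?thesis
    unfolding num_linear_extensions_def cyl_skew_eq .
qed

section \<open>Evaluation of the series and the theorem\<close>

lemma weight_has_sum:
  "(weight has_sum (real ((l + m - 2) choose (m - 1)) / fact (m + l - 1) / (real m + real l))) profiles"
proof -
  define e where "e n = (\<Sum>f\<in>level n. weight f * down_sum f)" for n
  have "(\<lambda>n. sum weight (level n)) sums
      (real ((l + m - 2) choose (m - 1)) / fact (m + l - 1) / (real m + real l))"
  proof (rule sums_of_telescoping_with_error)
    show "0 \<le> sum weight (level n)" for n by (intro sum_nonneg) (simp add: weight_nonneg)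
    show "0 \<le> e n" for n
      unfolding e_def by (intro sum_nonneg mult_nonneg_nonneg) (simp_all add: weight_nonneg down_sum_bounds)
    show "e n \<le> real (m * (m + 1)) * (real n + 1) * sum weight (level n)" for n
      unfolding e_def sum_distrib_left
    proof (rule sum_mono)
      fix f assume "f \<in> level n"
      then have "real_of_int (down_sum f) \<le> of_int (int (m * (m + 1) * (n + 1)))"
        unfolding of_int_le_iff by (rule down_sum_bounds)
      then have "real_of_int (down_sum f) \<le> real (m * (m + 1)) * (real n + 1)"
        by (simp add: algebra_simps)
      then show "weight f * down_sum f \<le> real (m * (m + 1)) * (real n + 1) * weight f"
        by (simp only: mult.commute[of "weight f"] mult_right_mono weight_nonneg)
    qed
    show "(real m + real l) * (\<Sum>k\<le>n. sum weight (level k)) + e n =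
        real ((l + m - 2) choose (m - 1)) / fact (m + l - 1)" if "n \<ge> m * l" for n
      using telescope_levels[OF that] by (simp only: e_def sum_rect_profiles)
    show "0 < real m + real l" using m_pos by simp
  qed
  then show ?thesis
    unfolding profiles_eq_levels
    by (rule has_sum_UNION_nat[OF disjoint_levels finite_level weight_nonneg])
qed

lemma excited_weight_has_sum:
  "(excited_weight m l lam has_sum
    (real ((l + m - 2) choose (m - 1)) / fact (m + l - 1) / (real m + real l))) (cyl_excited m l lam mu)"
  unfolding cyl_excited_eq has_sum_reindex[OF inj_on_complement_rim]
  using weight_has_sum by (simp add: excited_weight_eq o_def cong: has_sum_cong)

lemma g_sum_eq: "g_sum m l lam mu = real ((l + m - 2) choose (m - 1))"
proof -
  have "(\<Sum>i<m. lam ! i - mu ! i) = int m + int l"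
  proof -
    have "(\<Sum>i<m. lam ! i - mu ! i) = (\<Sum>i<m. 1 + (if i = m - 1 then int l else 0))"
      by (intro sum.cong) (auto simp: nth_append)
    then show ?thesis using m_pos by (simp add: sum.distrib)
  qed
  then have "nat (\<Sum>i<m. lam ! i - mu ! i) = m + l" by simp
  moreover have "fact (m + l) = (real m + real l) * fact (m + l - 1)"
    using m_pos by (subst fact_reduce) auto
  ultimately show ?thesis
    unfolding g_sum_def infsumI[OF excited_weight_has_sum] using m_pos by simp
qed

lemma lam_partition: "lam \<in> partitions m l"
  using m_pos by (simp add: partitions_def sorted_wrt_iff_nth_less)

lemma mu_partition: "mu \<in> partitions m l"
proof -
  have "sorted_wrt (\<ge>) (replicate k x)" for k and x :: int
    by (simp add: sorted_wrt_iff_nth_less)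
  \<comment> \<open>Only an inequality, because for m = 1 the head is the entry 0.\<close>
  moreover have "hd mu \<le> int l" by (cases "m - 1") auto
  ultimately show ?thesis
    using m_pos by (simp add: partitions_def sorted_wrt_append)
qed

end

theorem theorem5p9:
  fixes m l :: nat and lam mu :: "int list"
  assumes "m \<ge> 1" and "l \<ge> 1"
    and "lam = replicate m (int l + 1)"
    and "mu = replicate (m - 1) (int l) @ [0]"
  shows "lam \<in> partitions m l \<and> mu \<in> partitions m l \<and>
    num_linear_extensions m l lam mu = (l + m - 2) choose (m - 1) \<and>
    excited_weight m l lam summable_on cyl_excited m l lam mu \<and>
    g_sum m l lam mu = real ((l + m - 2) choose (m - 1))"
proof -
  interpret cylinder m l by unfold_locales (use assms in auto)
  show ?thesis
    unfolding assms(3,4)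
    using lam_partition mu_partition num_linear_extensions_eq g_sum_eq
      has_sum_imp_summable[OF excited_weight_has_sum] by blast
qed

end
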